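(* Let $\alpha,\beta,\theta$ be cost functions satisfying $\alpha+\beta=\theta$. Then for all probability measures $\mu,\nu$ on $\mathbb{R}$ with finite first moments, $$\overline{\mathcal{T}}_\theta(\nu|\mu)=\overline{\mathcal{T}}_\alpha(\nu|\mu)+\overline{\mathcal{T}}_\beta(\nu|\mu).$$
   Context: A cost function is an even convex function $\theta:\mathbb{R}\to[0,\infty)$ with $\theta(0)=0$. For probability measures $\mu,\nu$ on $\mathbb{R}$ with finite first moments, the weak transport cost is $$\overline{\mathcal{T}}_\theta(\nu|\mu)=\inf_\pi\int\theta\Big(\big|x-\textstyle\int y\,p(x,dy)\big|\Big)\,\mu(dx).$$ The infimum runs over all couplings $\pi(dx\,dy)=\mu(dx)p(x,dy)$ with first marginal $\mu$ and second marginal $\nu$. *)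

theory Defs
  imports "HOL-Probability.Probability"
begin

definition cost_function :: "(real \<Rightarrow> real) \<Rightarrow> bool" where
  "cost_function \<theta> \<longleftrightarrow> convex_on UNIV \<theta> \<and> (\<forall>x. \<theta> (-x) = \<theta> x)
     \<and> (\<forall>x. 0 \<le> \<theta> x) \<and> \<theta> 0 = 0"

definition prob_first_moment :: "real measure \<Rightarrow> bool" where
  "prob_first_moment \<mu> \<longleftrightarrow> sets \<mu> = sets borel \<and> prob_space \<mu> \<and> integrable \<mu> (\<lambda>x. x)"

text \<open>Weak transport cost. Couplings pi(dx dy) = mu(dx) p(x,dy) are given by
  Markov kernels p with first marginal mu and second marginal bind mu p = nu.
  Value in [0,\<infinity>].\<close>
definition weak_transport_cost ::
  "(real \<Rightarrow> real) \<Rightarrow> real measure \<Rightarrow> real measure \<Rightarrow> ennreal" where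
  "weak_transport_cost \<theta> \<nu> \<mu> =
     (INF p \<in> {p. p \<in> borel \<rightarrow>\<^sub>M prob_algebra borel \<and> bind \<mu> p = \<nu>}.
        \<integral>\<^sup>+ x. ennreal (\<theta> \<bar>x - (\<integral> y. y \<partial>(p x))\<bar>) \<partial>\<mu>)"

end

theory Submission
  imports Defs
begin

text \<open>One coupling is optimal for all cost functions at once. Let \<open>\<pi>\<close>, with barycentres \<open>b\<close>, minimise the cost
  for the strictly convex function \<open>sqrt (1 + z\<^sup>2)\<close> with bounded increasing derivative \<open>\<sigma>\<close>, and put
  \<open>f x = x - b x\<close>. The first-order condition says that \<open>\<pi>\<close> maximises the integral of \<open>\<sigma> (f x) * y\<close> among all
  couplings, that is, \<open>f x\<close> and \<open>y\<close> are comonotone under \<open>\<pi>\<close>. Then \<open>\<pi>\<close> also maximises the integral of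
  \<open>g (f x) * y\<close> for every nondecreasing \<open>g\<close>. With \<open>g\<close> a subgradient of a cost function \<open>\<theta>\<close>, convexity yields
  that \<open>\<pi>\<close> is optimal for \<open>\<theta>\<close>. Hence the three infima are attained at the same coupling.\<close>

section \<open>Conditional distribution functions\<close>

text \<open>With only first moments a quadratic auxiliary cost could be infinite.
  \<open>sqrt (1 + z\<^sup>2)\<close> grows linearly, so its cost is finite for every coupling, and
  its bounded derivative can be integrated against differences of barycentres. Replacing \<sigma> by
  another monotone \<open>g\<close> works because the linear functional splits over levels: up to
  sign and a constant, the integral of \<open>g (f x) * y\<close> is the integral over t of the
  \<mu>-integral of \<open>g (f x)\<close> times the conditional probability of y \<le> t. At fixed
  t the competitors are functions with values in [0,1] and prescribed integral, and for strictly
  increasing \<sigma> a minimiser must be 1 below a threshold of \<open>f\<close> and 0 above it.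
  That shape no longer mentions \<sigma>. The comonotone coupling has it at all levels
  simultaneously, so one competitor suffices. A subgradient may be unbounded and the cost infinite,
  hence a truncation, removed by Fatou's lemma. Conditional distribution functions turn couplings
  into a convex set of bounded functions, so a minimiser comes from a Hilbert space argument in
  place of weak compactness.\<close>

lemma (in real_distribution)
  assumes "integrable M (\<lambda>y. y)"
  shows integrable_step_minus_cdf: "integrable lborel (\<lambda>t. indicat_real {0<..} t - cdf M t)"
    and integral_step_minus_cdf: "(LINT t|lborel. indicat_real {0<..} t - cdf M t) = (LINT y|M. y)"
proof -
  interpret P: pair_sigma_finite M lborel ..
  \<comment> \<open>Layer-cake kernel: its integral over t is y, with the sign of y carried by the
    two indicators in \<open>\<phi>_eq\<close>, while its integral over y under \<open>M\<close> is
    the step function minus the distribution function. Fubini equates the iterated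
    integrals.\<close>
  define \<phi> :: "real \<Rightarrow> real \<Rightarrow> real" where "\<phi> y t = indicat_real {0<..} t - indicat_real {..t} y" for y t
  have \<phi>_eq: "\<phi> y = (\<lambda>t. indicat_real {0<..<y} t - indicat_real {y..0} t)" for y
    by (auto simp: \<phi>_def fun_eq_iff indicator_def)
  have \<phi>_abs: "\<bar>\<phi> y t\<bar> = indicat_real {0<..<y} t + indicat_real {y..0} t" for y t
    by (auto simp: \<phi>_eq indicator_def)
  have ind: "integrable lborel (indicat_real {0<..<y})" "integrable lborel (indicat_real {y..0})" for y :: real
    using emeasure_lborel_box_finite[of 0 y] emeasure_lborel_cbox_finite[of y 0] by (auto simp: integrable_indicator_iff)
  have int: "integrable lborel (\<phi> y)" for y
    unfolding \<phi>_eq using ind by (rule Bochner_Integration.integrable_diff)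
  have val: "(LINT t|lborel. \<phi> y t) = y" for y
    unfolding \<phi>_eq using ind[of y] by (subst Bochner_Integration.integral_diff) auto
  have nval: "(LINT t|lborel. norm (\<phi> y t)) = \<bar>y\<bar>" for y
    unfolding real_norm_def \<phi>_abs using ind[of y] by (subst Bochner_Integration.integral_add) auto
  have meas: "case_prod \<phi> \<in> borel_measurable (M \<Otimes>\<^sub>M lborel)"
  proof -
    have "case_prod \<phi> \<in> borel_measurable (borel \<Otimes>\<^sub>M borel)"
      unfolding \<phi>_def by (simp add: case_prod_beta' indicator_def) measurable
    then show ?thesis
      by (simp cong: measurable_cong_sets)
  qed
  have *: "integrable (M \<Otimes>\<^sub>M lborel) (case_prod \<phi>)"
    using assms by (intro P.Fubini_integrable meas) (auto simp: nval[unfolded real_norm_def] int)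
  have **: "(LINT y|M. \<phi> y t) = indicat_real {0<..} t - cdf M t" for t
    unfolding \<phi>_def cdf_def using prob_space
    by (subst Bochner_Integration.integral_diff) (auto simp: integrable_indicator_iff less_top[symmetric])
  show "integrable lborel (\<lambda>t. indicat_real {0<..} t - cdf M t)"
    using P.integrable_snd[OF *] by (simp add: **)
  show "(LINT t|lborel. indicat_real {0<..} t - cdf M t) = (LINT y|M. y)"
    using P.Fubini_integral[OF *] by (simp add: ** val)
qed

locale two_laws = mu: real_distribution \<mu> + nu: real_distribution \<nu> for \<mu> \<nu> +
  assumes integrable_mu: "integrable \<mu> (\<lambda>x. x)"
    and integrable_nu: "integrable \<nu> (\<lambda>y. y)"
begin

sublocale P: pair_sigma_finite lborel \<mu> ..

lemma borel_measurable_pair_iff: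
  "f \<in> borel_measurable (lborel \<Otimes>\<^sub>M \<mu>) \<longleftrightarrow> f \<in> borel_measurable (borel \<Otimes>\<^sub>M borel)"
  by (simp cong: measurable_cong_sets)

text \<open>\<open>F t x\<close> stands for the conditional probability of \<open>y \<le> t\<close> given \<open>x\<close>, so \<open>F\<close> encodes a coupling of
  \<open>\<mu>\<close> and \<open>\<nu>\<close>. Right continuity in \<open>t\<close> and the limits at infinity are left out, which makes the set stable
  under limits almost everywhere; \<open>kernel_of_cond_cdf\<close> recovers them. The mean of the law with
  distribution function \<open>F\<close> is the integral of \<open>1\<^bsub>t > 0\<^esub> - F t\<close>, whence \<open>bary\<close>.\<close>

definition cond_cdfs :: "(real \<Rightarrow> real \<Rightarrow> real) set" where
  "cond_cdfs = {F. case_prod F \<in> borel_measurable (borel \<Otimes>\<^sub>M borel)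
     \<and> (\<forall>t x. 0 \<le> F t x \<and> F t x \<le> 1) \<and> (\<forall>s t x. s \<le> t \<longrightarrow> F s x \<le> F t x)
     \<and> (AE t in lborel. (LINT x|\<mu>. F t x) = cdf \<nu> t)}"

definition bary :: "(real \<Rightarrow> real \<Rightarrow> real) \<Rightarrow> real \<Rightarrow> real" where
  "bary F x = (LINT t|lborel. indicat_real {0<..} t - F t x)"

lemma cond_cdfsD:
  assumes "F \<in> cond_cdfs"
  shows "case_prod F \<in> borel_measurable (borel \<Otimes>\<^sub>M borel)" "0 \<le> F t x" "F t x \<le> 1"
    "s \<le> t \<Longrightarrow> F s x \<le> F t x" "AE t in lborel. (LINT x|\<mu>. F t x) = cdf \<nu> t"
  using assms by (auto simp: cond_cdfs_def)

lemma cond_cdfs_measurable: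
  assumes "F \<in> cond_cdfs"
  shows "case_prod F \<in> borel_measurable (lborel \<Otimes>\<^sub>M \<mu>)" "F t \<in> borel_measurable \<mu>"
proof -
  note [measurable] = cond_cdfsD(1)[OF assms]
  show "case_prod F \<in> borel_measurable (lborel \<Otimes>\<^sub>M \<mu>)"
    by (simp add: borel_measurable_pair_iff cond_cdfsD(1)[OF assms])
  have "F t \<in> borel_measurable borel" by measurable
  then show "F t \<in> borel_measurable \<mu>" by (simp cong: measurable_cong_sets)
qed

lemma cond_cdfs_integrable:
  assumes "F \<in> cond_cdfs"
  shows "integrable \<mu> (F t)"
  using cond_cdfsD[OF assms] cond_cdfs_measurable[OF assms]
  by (intro mu.integrable_const_bound[where B=1]) auto

text \<open>For fixed t the integrand keeps one sign in x, since \<open>F t x\<close> lies between 0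
  and 1, so the absolute value commutes with the integral and only the marginal remains. This gives
  one integrable majorant in t for all couplings at once.\<close>

lemma integral_abs_step_minus:
  assumes "F \<in> cond_cdfs"
  shows "AE t in lborel. (LINT x|\<mu>. \<bar>indicat_real {0<..} t - F t x\<bar>) = \<bar>indicat_real {0<..} t - cdf \<nu> t\<bar>"
  using cond_cdfsD(5)[OF assms]
proof eventually_elim
  case (elim t)
  have "(LINT x|\<mu>. \<bar>indicat_real {0<..} t - F t x\<bar>) = \<bar>LINT x|\<mu>. indicat_real {0<..} t - F t x\<bar>"
  proof (cases "t > 0")
    case True
    have "0 \<le> (LINT x|\<mu>. 1 - F t x)"
      using cond_cdfsD[OF assms] by (intro integral_nonneg_AE) auto
    then show ?thesis using True cond_cdfsD[OF assms] by (simp add: abs_of_nonneg del: Bochner_Integration.integral_diff)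
  next
    case False
    have "0 \<le> (LINT x|\<mu>. F t x)"
      using cond_cdfsD[OF assms] by (intro integral_nonneg_AE) auto
    then show ?thesis using False cond_cdfsD[OF assms] by simp
  qed
  also have "(LINT x|\<mu>. indicat_real {0<..} t - F t x) = indicat_real {0<..} t - cdf \<nu> t"
    using cond_cdfs_integrable[OF assms, of t] elim mu.prob_space by simp
  finally show ?case .
qed

lemma integrable_step_minus_pair:
  assumes "F \<in> cond_cdfs"
  shows "integrable (lborel \<Otimes>\<^sub>M \<mu>) (\<lambda>(t, x). indicat_real {0<..} t - F t x)"
proof (rule P.Fubini_integrable)
  show "(\<lambda>(t, x). indicat_real {0<..} t - F t x) \<in> borel_measurable (lborel \<Otimes>\<^sub>M \<mu>)"
    using cond_cdfsD(1)[OF assms] by measurable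
  have "integrable lborel (\<lambda>t. \<bar>indicat_real {0<..} t - cdf \<nu> t\<bar>)"
    using nu.integrable_step_minus_cdf[OF integrable_nu] by (rule integrable_abs)
  moreover have "(\<lambda>t. LINT x|\<mu>. \<bar>indicat_real {0<..} t - F t x\<bar>) \<in> borel_measurable lborel"
    proof (rule mu.borel_measurable_lebesgue_integral)
    show "(\<lambda>(t, x). \<bar>indicat_real {0<..} t - F t x\<bar>) \<in> borel_measurable (lborel \<Otimes>\<^sub>M \<mu>)"
      using cond_cdfsD(1)[OF assms] by measurable
  qed
  ultimately show "integrable lborel (\<lambda>t. LINT x|\<mu>. norm (case (t, x) of (t, x) \<Rightarrow> indicat_real {0<..} t - F t x))"
    using integral_abs_step_minus[OF assms]
    by (subst integrable_cong_AE[where g="\<lambda>t. \<bar>indicat_real {0<..} t - cdf \<nu> t\<bar>"]) (auto simp: cond_cdfs_def)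
  show "AE t in lborel. integrable \<mu> (\<lambda>x. case (t, x) of (t, x) \<Rightarrow> indicat_real {0<..} t - F t x)"
    using cond_cdfs_integrable[OF assms] by simp
qed

lemma integrable_bary:
  assumes "F \<in> cond_cdfs"
  shows "integrable \<mu> (bary F)"
  using P.integrable_snd[OF integrable_step_minus_pair[OF assms]] by (simp add: bary_def[abs_def])

lemma AE_integrable_step_minus:
  assumes "F \<in> cond_cdfs"
  shows "AE x in \<mu>. integrable lborel (\<lambda>t. indicat_real {0<..} t - F t x)"
  using P.AE_integrable_snd[OF integrable_step_minus_pair[OF assms]] by simp

lemma integrable_diff_pair:
  assumes "F \<in> cond_cdfs" "G \<in> cond_cdfs"
  shows "integrable (lborel \<Otimes>\<^sub>M \<mu>) (\<lambda>(t, x). F t x - G t x)"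
  using Bochner_Integration.integrable_diff[OF integrable_step_minus_pair[OF assms(2)] integrable_step_minus_pair[OF assms(1)]]
  by (simp add: case_prod_beta')

lemma bary_diff:
  assumes "F \<in> cond_cdfs" "G \<in> cond_cdfs"
  shows "AE x in \<mu>. bary G x - bary F x = (LINT t|lborel. F t x - G t x)"
  using AE_integrable_step_minus[OF assms(1)] AE_integrable_step_minus[OF assms(2)]
proof eventually_elim
  case (elim x)
  then show ?case
    unfolding bary_def by (subst Bochner_Integration.integral_diff[symmetric]) auto
qed

text \<open>Fubini reduces a linear functional of the barycentre to its slices. A larger
  distribution function means a smaller mean, whence the exchange of \<open>F\<close> and
  \<open>G\<close> on the right.\<close>

lemma weighted_bary_diff:
  assumes "F \<in> cond_cdfs" "G \<in> cond_cdfs" and g: "g \<in> borel_measurable \<mu>" "\<And>x. \<bar>g x\<bar> \<le> B"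
  shows "integrable lborel (\<lambda>t. LINT x|\<mu>. g x * (F t x - G t x))"
    and "(LINT x|\<mu>. g x * (bary G x - bary F x)) = (LINT t|lborel. LINT x|\<mu>. g x * (F t x - G t x))"
proof -
  have int: "integrable (lborel \<Otimes>\<^sub>M \<mu>) (\<lambda>(t, x). g x * (F t x - G t x))"
  proof (rule Bochner_Integration.integrable_bound)
    show "integrable (lborel \<Otimes>\<^sub>M \<mu>) (\<lambda>z. B * (case z of (t, x) \<Rightarrow> F t x - G t x))"
      using integrable_diff_pair[OF assms(1,2)] by (rule integrable_mult_right)
    show "(\<lambda>(t, x). g x * (F t x - G t x)) \<in> borel_measurable (lborel \<Otimes>\<^sub>M \<mu>)"
      using cond_cdfs_measurable(1)[OF assms(1)] cond_cdfs_measurable(1)[OF assms(2)] g(1) by measurable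
    have "0 \<le> B" using g(2)[of undefined] by linarith
    then have "\<bar>g x * (F t x - G t x)\<bar> \<le> \<bar>B * (F t x - G t x)\<bar>" for t x
      using g(2)[of x] by (simp add: abs_mult mult_right_mono)
    then show "AE z in lborel \<Otimes>\<^sub>M \<mu>. norm (case z of (t, x) \<Rightarrow> g x * (F t x - G t x))
        \<le> norm (B * (case z of (t, x) \<Rightarrow> F t x - G t x))"
      by (auto split: prod.split)
  qed
  show "integrable lborel (\<lambda>t. LINT x|\<mu>. g x * (F t x - G t x))"
    using P.integrable_fst[OF int] by simp
  have "(LINT x|\<mu>. g x * (bary G x - bary F x)) = (LINT x|\<mu>. LINT t|lborel. g x * (F t x - G t x))"
  proof (rule integral_cong_AE)
    show "(\<lambda>x. g x * (bary G x - bary F x)) \<in> borel_measurable \<mu>"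
      using g(1) integrable_bary[OF assms(1)] integrable_bary[OF assms(2)] by measurable
    show "(\<lambda>x. LINT t|lborel. g x * (F t x - G t x)) \<in> borel_measurable \<mu>"
      using P.integrable_snd[OF int] by (simp add: borel_measurable_integrable)
    show "AE x in \<mu>. g x * (bary G x - bary F x) = (LINT t|lborel. g x * (F t x - G t x))"
      using bary_diff[OF assms(1,2)] by eventually_elim simp
  qed
  also have "\<dots> = (LINT t|lborel. LINT x|\<mu>. g x * (F t x - G t x))"
    using P.Fubini_integral[OF int] .
  finally show "(LINT x|\<mu>. g x * (bary G x - bary F x)) = (LINT t|lborel. LINT x|\<mu>. g x * (F t x - G t x))" .
qed

text \<open>The barycentre is affine only almost everywhere: where its integrand is not integrable,
  \<open>bary\<close> takes the default value 0.\<close>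

lemma cond_cdfs_convex:
  assumes FG: "F \<in> cond_cdfs" "G \<in> cond_cdfs" and s: "0 \<le> s" "s \<le> 1"
  shows "(\<lambda>t x. (1 - s) * F t x + s * G t x) \<in> cond_cdfs"
    and "AE x in \<mu>. bary (\<lambda>t x. (1 - s) * F t x + s * G t x) x = (1 - s) * bary F x + s * bary G x"
proof -
  note F = cond_cdfsD[OF FG(1)] and G = cond_cdfsD[OF FG(2)]
  have "AE t in lborel. (LINT x|\<mu>. (1 - s) * F t x + s * G t x) = cdf \<nu> t"
    using F(5) G(5)
  proof eventually_elim
    case (elim t)
    then show ?case
      using cond_cdfs_integrable[OF FG(1), of t] cond_cdfs_integrable[OF FG(2), of t]
      by (simp add: algebra_simps)
  qed
  moreover have "(1 - s) * F t x + s * G t x \<le> 1" for t x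
    using convex_bound_le[of "F t x" 1 "G t x" "1 - s" s] F(3) G(3) s by simp
  moreover have "case_prod (\<lambda>t x. (1 - s) * F t x + s * G t x) \<in> borel_measurable (borel \<Otimes>\<^sub>M borel)"
    using F(1) G(1) by measurable
  ultimately show "(\<lambda>t x. (1 - s) * F t x + s * G t x) \<in> cond_cdfs"
    using F(2,4) G(2,4) s by (auto simp: cond_cdfs_def intro!: add_mono mult_left_mono)
  show "AE x in \<mu>. bary (\<lambda>t x. (1 - s) * F t x + s * G t x) x = (1 - s) * bary F x + s * bary G x"
    using AE_integrable_step_minus[OF FG(1)] AE_integrable_step_minus[OF FG(2)]
  proof eventually_elim
    case (elim x)
    have "bary (\<lambda>t x. (1 - s) * F t x + s * G t x) x
        = (LINT t|lborel. (1 - s) * (indicat_real {0<..} t - F t x) + s * (indicat_real {0<..} t - G t x))"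
      unfolding bary_def by (rule Bochner_Integration.integral_cong) (auto simp: algebra_simps)
    also have "\<dots> = (1 - s) * bary F x + s * bary G x"
      unfolding bary_def using elim by (subst Bochner_Integration.integral_add) auto
    finally show ?case .
  qed
qed

end

section \<open>The bathtub principle and universal optimality\<close>

text \<open>As a function of \<open>s\<close>, the indicator of the lower \<open>n\<close>-quantile part of \<open>M\<close>, taking a fractional value
  on an atom that has to be split.\<close>

definition bathtub :: "real measure \<Rightarrow> real \<Rightarrow> real \<Rightarrow> real" where
  "bathtub M n s =
     (if 1 \<le> n \<or> cdf M s < n then 1
      else if n \<le> measure M {..<s} then 0
      else (n - measure M {..<s}) / (cdf M s - measure M {..<s}))"

context real_distribution
begin

lemma bathtub_bounds: "0 \<le> bathtub M n s" "bathtub M n s \<le> 1"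
  by (auto simp: bathtub_def divide_le_eq_1)

lemma bathtub_mono: "m \<le> n \<Longrightarrow> bathtub M m s \<le> bathtub M n s"
  by (auto simp: bathtub_def divide_le_eq_1 intro!: divide_right_mono)

lemma borel_measurable_measure_lessThan: "(\<lambda>s. measure M {..<s}) \<in> borel_measurable borel"
  by (intro borel_measurable_mono monoI finite_measure_mono) auto

lemma borel_measurable_cdf: "cdf M \<in> borel_measurable borel"
  by (intro borel_measurable_mono monoI cdf_nondecreasing)

lemma borel_measurable_bathtub:
  "case_prod (bathtub M) \<in> borel_measurable (borel \<Otimes>\<^sub>M borel)"
proof -
  note [measurable] = borel_measurable_measure_lessThan borel_measurable_cdf
  show ?thesis unfolding bathtub_def by measurable
qed

text \<open>The threshold is the n-quantile \<open>I n\<close>, the generalised inverse of the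
  distribution function, which is finite because n lies strictly between 0 and 1. The last two
  inequalities place n inside the possible jump at the quantile.\<close>

lemma bathtub_threshold:
  assumes n: "0 < n" "n < 1"
  shows "\<exists>c. (\<forall>s<c. bathtub M n s = 1) \<and> (\<forall>s>c. bathtub M n s = 0) \<and> measure M {..<c} \<le> n \<and> n \<le> cdf M c"
proof -
  interpret cdf_distribution M ..
  define c where "c = I n"
  have c: "n \<le> cdf M s \<longleftrightarrow> c \<le> s" for s
    unfolding c_def using n by (rule pseudoinverse)
  show ?thesis
  proof (intro exI[of _ c] conjI allI impI)
    show "bathtub M n s = 1" if "s < c" for s
      using that c[of s] by (simp add: bathtub_def)
    show "bathtub M n s = 0" if "c < s" for s
    proof -
      have "n \<le> cdf M c" using c by simp
      also have "cdf M c \<le> measure M {..<s}"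
        unfolding cdf_def using that by (intro finite_measure_mono) auto
      finally show ?thesis
        using that n c[of s] by (simp add: bathtub_def)
    qed
    show "n \<le> cdf M c" using c by simp
    show "measure M {..<c} \<le> n"
    proof (rule tendsto_upperbound[OF cdf_at_left])
      show "\<forall>\<^sub>F s in at_left c. cdf M s \<le> n"
        using c by (auto simp: eventually_at_filter not_le[symmetric] intro!: always_eventually less_imp_le)
    qed simp
  qed
qed

text \<open>Mass below the quantile counts fully; the fraction put on an atom at the quantile tops
  it up to exactly n.\<close>

lemma integral_bathtub:
  assumes "0 \<le> n" "n \<le> 1"
  shows "(LINT s|M. bathtub M n s) = n"
proof -
  consider "n = 0" | "n = 1" | "0 < n" "n < 1" using assms by linarith
  then show ?thesis
  proof cases
    case 1
    then have "bathtub M n s = 0" for s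
      using cdf_nonneg[of s] by (simp add: bathtub_def not_less)
    then show ?thesis using 1 by simp
  next
    case 2
    then show ?thesis using prob_space by (simp add: bathtub_def)
  next
    case 3
    obtain c where c: "\<And>s. s < c \<Longrightarrow> bathtub M n s = 1" "\<And>s. c < s \<Longrightarrow> bathtub M n s = 0"
      "measure M {..<c} \<le> n" "n \<le> cdf M c"
      using bathtub_threshold[OF 3] by blast
    have eq: "bathtub M n = (\<lambda>s. indicator {..<c} s + bathtub M n c * indicator {c} s)"
    proof
      fix s show "bathtub M n s = indicator {..<c} s + bathtub M n c * indicator {c} s"
        using c(1,2)[of s] by (cases s c rule: linorder_cases) auto
    qed
    have "(LINT s|M. indicator {..<c} s + bathtub M n c * indicator {c} s)
        = measure M {..<c} + bathtub M n c * measure M {c}"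
      by (subst Bochner_Integration.integral_add) (auto simp: integrable_indicator_iff less_top[symmetric])
    also have "measure M {c} = cdf M c - measure M {..<c}"
      unfolding cdf_def ivl_disj_un(2)[symmetric] by (subst finite_measure_Union) auto
    also have "bathtub M n c * (cdf M c - measure M {..<c}) = n - measure M {..<c}"
      using 3 c(3,4) by (auto simp: bathtub_def)
    finally show ?thesis using eq by simp
  qed
qed

lemma AE_eq_0_if_integral_eq_0:
  fixes u :: "real \<Rightarrow> real"
  assumes "integrable M u" "\<And>x. 0 \<le> u x" "(LINT x|M. u x) = 0"
  shows "AE x in M. u x = 0"
  using integral_nonneg_eq_0_iff_AE[of M u] assms by auto

text \<open>As \<open>u\<close> and \<open>v\<close> have equal integrals, the constant
  \<open>\<psi> c\<close> may be subtracted from \<psi>. On either side of the threshold the factors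
  \<open>\<psi> (f x) - \<psi> c\<close> and \<open>v x - u x\<close> then have the same sign, so
  the integrand is nonnegative, and a vanishing integral forces it to vanish almost
  everywhere.\<close>

lemma threshold_optimal:
  fixes f \<psi> u v :: "real \<Rightarrow> real"
  assumes f: "f \<in> borel_measurable M"
    and \<psi>: "mono \<psi>" "\<And>s. \<bar>\<psi> s\<bar> \<le> B"
    and u: "integrable M u"
    and thr: "AE x in M. (f x < c \<longrightarrow> u x = 1) \<and> (c < f x \<longrightarrow> u x = 0)"
    and v: "integrable M v" "\<And>x. 0 \<le> v x" "\<And>x. v x \<le> 1"
    and eq: "(LINT x|M. u x) = (LINT x|M. v x)"
  shows "integrable M (\<lambda>x. \<psi> (f x) * (v x - u x))"
    and "0 \<le> (LINT x|M. \<psi> (f x) * (v x - u x))"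
    and "(LINT x|M. \<psi> (f x) * (v x - u x)) \<le> 0 \<Longrightarrow> AE x in M. \<psi> (f x) = \<psi> c \<or> v x = u x"
proof -
  note [measurable] = borel_measurable_mono[OF \<psi>(1)] f
  have int: "integrable M (\<lambda>x. \<psi> (f x) * (v x - u x))"
  proof (rule Bochner_Integration.integrable_bound)
    show "integrable M (\<lambda>x. B * (v x - u x))"
      using u v by simp
    show "(\<lambda>x. \<psi> (f x) * (v x - u x)) \<in> borel_measurable M"
      using u v by measurable
    have "0 \<le> B" using \<psi>(2)[of undefined] by linarith
    then show "AE x in M. norm (\<psi> (f x) * (v x - u x)) \<le> norm (B * (v x - u x))"
      using \<psi>(2) by (auto simp: abs_mult intro!: mult_right_mono)
  qed
  then show "integrable M (\<lambda>x. \<psi> (f x) * (v x - u x))" .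
  have intc: "integrable M (\<lambda>x. (\<psi> (f x) - \<psi> c) * (v x - u x))"
    using int u v by (simp add: left_diff_distrib)
  have split: "(LINT x|M. \<psi> (f x) * (v x - u x)) = (LINT x|M. (\<psi> (f x) - \<psi> c) * (v x - u x))"
  proof -
    have "(LINT x|M. (\<psi> (f x) - \<psi> c) * (v x - u x))
        = (LINT x|M. \<psi> (f x) * (v x - u x) - \<psi> c * (v x - u x))"
      by (simp add: left_diff_distrib)
    also have "\<dots> = (LINT x|M. \<psi> (f x) * (v x - u x)) - (LINT x|M. \<psi> c * (v x - u x))"
      using int u v by (intro Bochner_Integration.integral_diff) auto
    also have "(LINT x|M. \<psi> c * (v x - u x)) = 0"
      using u v eq by simp
    finally show ?thesis by simp
  qed
  have nonneg: "AE x in M. 0 \<le> (\<psi> (f x) - \<psi> c) * (v x - u x)"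
    using thr
  proof eventually_elim
    case (elim x)
    consider "f x < c" | "f x = c" | "c < f x" by linarith
    then show ?case
    proof cases
      case 1
      then show ?thesis using elim v(3)[of x] monoD[OF \<psi>(1), of "f x" c]
        by (auto intro!: mult_nonpos_nonpos)
    next
      case 3
      then show ?thesis using elim v(2)[of x] monoD[OF \<psi>(1), of c "f x"] by simp
    qed simp
  qed
  show nn: "0 \<le> (LINT x|M. \<psi> (f x) * (v x - u x))"
    unfolding split using nonneg by (rule integral_nonneg_AE)
  assume "(LINT x|M. \<psi> (f x) * (v x - u x)) \<le> 0"
  then have "(LINT x|M. (\<psi> (f x) - \<psi> c) * (v x - u x)) = 0"
    using nn split by linarith
  then show "AE x in M. \<psi> (f x) = \<psi> c \<or> v x = u x"
    using integral_nonneg_eq_0_iff_AE[OF intc nonneg] by auto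
qed

text \<open>Strictness of \<sigma> identifies the equality case: a \<open>u\<close> that ties with
  the bathtub function agrees with it almost everywhere off the level set where \<open>f x\<close>
  is the threshold. On that level set the two may differ, but optimality for a monotone \<psi> only
  uses the values off it, so \<open>u\<close> inherits it.\<close>

lemma bathtub_optimal:
  fixes f \<sigma> u :: "real \<Rightarrow> real"
  assumes f: "f \<in> borel_measurable M"
    and \<sigma>: "strict_mono \<sigma>" "\<And>s. \<bar>\<sigma> s\<bar> \<le> B"
    and u: "integrable M u" "\<And>x. 0 \<le> u x" "\<And>x. u x \<le> 1" "(LINT x|M. u x) = n"
  shows "0 \<le> (LINT x|M. \<sigma> (f x) * (u x - bathtub (distr M borel f) n (f x)))" (is ?nonneg)
    and "(LINT x|M. \<sigma> (f x) * (u x - bathtub (distr M borel f) n (f x))) \<le> 0 \<Longrightarrow>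
      integrable M v \<Longrightarrow> (\<And>x. 0 \<le> v x) \<Longrightarrow> (\<And>x. v x \<le> 1) \<Longrightarrow> (LINT x|M. v x) = n \<Longrightarrow>
      mono \<psi> \<Longrightarrow> (\<And>s. \<bar>\<psi> s\<bar> \<le> C) \<Longrightarrow> 0 \<le> (LINT x|M. \<psi> (f x) * (v x - u x))"
      (is "?le0 \<Longrightarrow> ?v1 \<Longrightarrow> PROP ?v2 \<Longrightarrow> PROP ?v3 \<Longrightarrow> ?v4 \<Longrightarrow> ?p1 \<Longrightarrow> PROP ?p2 \<Longrightarrow> ?concl")
proof -
  define \<Lambda> where "\<Lambda> = distr M borel f"
  interpret \<Lambda>: real_distribution \<Lambda>
    unfolding \<Lambda>_def using f by (rule real_distribution_distr)
  have n: "0 \<le> n" "n \<le> 1"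
    using u integral_nonneg_AE[of u M] integral_mono[of M u "\<lambda>_. 1"] prob_space by auto
  have G_meas: "bathtub \<Lambda> n \<in> borel_measurable borel"
    using \<Lambda>.borel_measurable_bathtub by measurable
  have G: "integrable M (\<lambda>x. bathtub \<Lambda> n (f x))"
    using G_meas f \<Lambda>.bathtub_bounds by (intro integrable_const_bound[where B=1]) auto
  have G_int: "(LINT x|M. bathtub \<Lambda> n (f x)) = n"
    using \<Lambda>.integral_bathtub[OF n] integral_distr[OF f G_meas] by (simp add: \<Lambda>_def)
  \<comment> \<open>At \<open>n = 0\<close> and \<open>n = 1\<close> a finite quantile need not
    exist, but there any two competitors agree almost everywhere and the integrals vanish.\<close>
  consider "n = 0" | "n = 1" | "0 < n" "n < 1" using n by linarith
  then have "?nonneg \<and> (?le0 \<longrightarrow> (\<forall>v \<psi> C. integrable M v \<longrightarrow> (\<forall>x. 0 \<le> v x \<and> v x \<le> 1) \<longrightarrow>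
    (LINT x|M. v x) = n \<longrightarrow> mono \<psi> \<longrightarrow> (\<forall>s. \<bar>\<psi> s\<bar> \<le> C) \<longrightarrow>
    0 \<le> (LINT x|M. \<psi> (f x) * (v x - u x))))"
  proof cases
    case 1
    have *: "AE x in M. v x = 0" if "integrable M v" "\<And>x. 0 \<le> v x" "(LINT x|M. v x) = n" for v :: "real \<Rightarrow> real"
      using AE_eq_0_if_integral_eq_0[of v] that 1 by auto
    have "AE x in M. \<psi> (f x) * (v x - w x) = 0"
      if "integrable M v" "\<And>x. 0 \<le> v x" "(LINT x|M. v x) = n"
        "integrable M w" "\<And>x. 0 \<le> w x" "(LINT x|M. w x) = n" for \<psi> v w :: "real \<Rightarrow> real"
      using *[OF that(1-3)] *[OF that(4-6)] by eventually_elim simp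
    note zero = integral_eq_zero_AE[OF this]
    have "(LINT x|M. \<sigma> (f x) * (u x - bathtub \<Lambda> n (f x))) = 0"
      using zero[of u "\<lambda>x. bathtub \<Lambda> n (f x)" \<sigma>] u G G_int \<Lambda>.bathtub_bounds by blast
    moreover have "(LINT x|M. \<psi> (f x) * (v x - u x)) = 0"
      if "integrable M v" "\<forall>x. 0 \<le> v x \<and> v x \<le> 1" "(LINT x|M. v x) = n" for v \<psi>
      using zero[of v u \<psi>] u that by blast
    ultimately show ?thesis
      unfolding \<Lambda>_def[symmetric] by simp
  next
    case 2
    have *: "AE x in M. 1 - v x = 0" if "integrable M v" "\<And>x. v x \<le> 1" "(LINT x|M. v x) = n" for v :: "real \<Rightarrow> real"
      using AE_eq_0_if_integral_eq_0[of "\<lambda>x. 1 - v x"] that 2 prob_space by auto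
    have "AE x in M. \<psi> (f x) * (v x - w x) = 0"
      if "integrable M v" "\<And>x. v x \<le> 1" "(LINT x|M. v x) = n"
        "integrable M w" "\<And>x. w x \<le> 1" "(LINT x|M. w x) = n" for \<psi> v w :: "real \<Rightarrow> real"
      using *[OF that(1-3)] *[OF that(4-6)] by eventually_elim simp
    note zero = integral_eq_zero_AE[OF this]
    have "(LINT x|M. \<sigma> (f x) * (u x - bathtub \<Lambda> n (f x))) = 0"
      using zero[of u "\<lambda>x. bathtub \<Lambda> n (f x)" \<sigma>] u G G_int \<Lambda>.bathtub_bounds by blast
    moreover have "(LINT x|M. \<psi> (f x) * (v x - u x)) = 0"
      if "integrable M v" "\<forall>x. 0 \<le> v x \<and> v x \<le> 1" "(LINT x|M. v x) = n" for v \<psi>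
      using zero[of v u \<psi>] u that by blast
    ultimately show ?thesis
      unfolding \<Lambda>_def[symmetric] by simp
  next
    case 3
    obtain c where c: "\<And>s. s < c \<Longrightarrow> bathtub \<Lambda> n s = 1" "\<And>s. c < s \<Longrightarrow> bathtub \<Lambda> n s = 0"
      using \<Lambda>.bathtub_threshold[OF 3] by blast
    have thr: "AE x in M. (f x < c \<longrightarrow> bathtub \<Lambda> n (f x) = 1) \<and> (c < f x \<longrightarrow> bathtub \<Lambda> n (f x) = 0)"
      using c by auto
    have "AE x in M. (f x < c \<longrightarrow> u x = 1) \<and> (c < f x \<longrightarrow> u x = 0)"
      if "(LINT x|M. \<sigma> (f x) * (u x - bathtub \<Lambda> n (f x))) \<le> 0"
      using threshold_optimal(3)[OF f strict_mono_mono[OF \<sigma>(1)] \<sigma>(2) G thr u(1-3) _ that]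
      unfolding G_int using u(4) c strict_mono_eq[OF \<sigma>(1)] by force
    then have "0 \<le> (LINT x|M. \<psi> (f x) * (v x - u x))"
      if "(LINT x|M. \<sigma> (f x) * (u x - bathtub \<Lambda> n (f x))) \<le> 0" "integrable M v"
        "\<forall>x. 0 \<le> v x \<and> v x \<le> 1" "(LINT x|M. v x) = n" "mono \<psi>" "\<forall>s. \<bar>\<psi> s\<bar> \<le> C" for v \<psi> C
      using threshold_optimal(2)[where f=f and \<psi>=\<psi> and u=u and v=v and c=c and B=C] f u(1,4) that by simp
    moreover have "0 \<le> (LINT x|M. \<sigma> (f x) * (u x - bathtub \<Lambda> n (f x)))"
      using threshold_optimal(2)[OF f strict_mono_mono[OF \<sigma>(1)] \<sigma>(2) G thr u(1-3)] G_int u(4) by simp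
    ultimately show ?thesis
      unfolding \<Lambda>_def[symmetric] by blast
  qed
  then show ?nonneg "?le0 \<Longrightarrow> ?v1 \<Longrightarrow> PROP ?v2 \<Longrightarrow> PROP ?v3 \<Longrightarrow> ?v4 \<Longrightarrow> ?p1 \<Longrightarrow> PROP ?p2 \<Longrightarrow> ?concl"
    by blast+
qed

end

section \<open>Subgradients and optimality for every cost function\<close>

lemma convex_subgradient:
  fixes \<theta> :: "real \<Rightarrow> real"
  assumes "convex_on UNIV \<theta>"
  obtains g where "\<And>x y. \<theta> x + g x * (y - x) \<le> \<theta> y" "mono g"
proof -
  \<comment> \<open>\<open>g x\<close> is the right derivative, as the infimum of the slopes of
    chords from x to points on its right.\<close>
  define g where "g x = Inf ((\<lambda>t. (\<theta> x - \<theta> t) / (x - t)) ` ({x<..} \<inter> UNIV))" for x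
  have g: "\<theta> x + g x * (y - x) \<le> \<theta> y" for x y
    unfolding g_def by (rule convex_le_Inf_differential[OF assms]) auto
  have "mono g"
  proof (rule monoI)
    fix x y :: real assume "x \<le> y"
    have "(g x - g y) * (y - x) \<le> 0"
      using g[of x y] g[of y x] by (simp add: algebra_simps)
    then show "g x \<le> g y"
      using \<open>x \<le> y\<close> by (cases "x = y") (auto simp: mult_le_0_iff)
  qed
  with g show ?thesis by (rule that)
qed

context two_laws
begin

text \<open>This is the comonotone coupling of \<open>f x\<close> and y: low values of
  \<open>f\<close> receive the low part of \<nu>, and atoms of the law of \<open>f\<close> are split
  by randomisation. Monotonicity of \<open>bathtub\<close> in its level makes the slices fit
  together into one conditional law.\<close>

lemma bathtub_in_cond_cdfs:
  assumes "f \<in> borel_measurable borel"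
  shows "(\<lambda>t x. bathtub (distr \<mu> borel f) (cdf \<nu> t) (f x)) \<in> cond_cdfs"
proof -
  define \<Lambda> where "\<Lambda> = distr \<mu> borel f"
  have f: "f \<in> borel_measurable \<mu>" using assms by simp
  interpret \<Lambda>: real_distribution \<Lambda>
    unfolding \<Lambda>_def using f by (rule mu.real_distribution_distr)
  note [measurable] = assms nu.borel_measurable_cdf \<Lambda>.borel_measurable_bathtub
  have "(LINT x|\<mu>. bathtub \<Lambda> n (f x)) = n" if "0 \<le> n" "n \<le> 1" for n
  proof -
    have "bathtub \<Lambda> n \<in> borel_measurable borel" by measurable
    then show ?thesis
      using \<Lambda>.integral_bathtub[OF that] integral_distr[OF f, of "bathtub \<Lambda> n"] by (simp add: \<Lambda>_def)
  qed
  moreover have "(\<lambda>(t, x). bathtub \<Lambda> (cdf \<nu> t) (f x)) \<in> borel_measurable (borel \<Otimes>\<^sub>M borel)"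
    by measurable
  ultimately show ?thesis
    unfolding \<Lambda>_def[symmetric]
    using \<Lambda>.bathtub_bounds \<Lambda>.bathtub_mono nu.cdf_nonneg nu.cdf_bounded_prob nu.cdf_nondecreasing
    by (auto simp: cond_cdfs_def)
qed

text \<open>Stationarity, tested against the bathtub coupling, forces every slice \<open>F t\<close> to be of bathtub type for
  \<open>f x = x - bary F x\<close>. This property only depends on the order of the values of \<open>f\<close>, so \<open>\<sigma>\<close> may be replaced
  by a subgradient of any cost function.\<close>

lemma stationary_imp_optimal:
  fixes \<sigma> \<theta> :: "real \<Rightarrow> real"
  assumes F: "F \<in> cond_cdfs" and \<theta>: "cost_function \<theta>"
    and \<sigma>: "strict_mono \<sigma>" "\<And>s. \<bar>\<sigma> s\<bar> \<le> B"
    and stat: "\<And>G. G \<in> cond_cdfs \<Longrightarrow> (LINT x|\<mu>. \<sigma> (x - bary F x) * (bary G x - bary F x)) \<le> 0"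
    and G: "G \<in> cond_cdfs"
  shows "(\<integral>\<^sup>+x. ennreal (\<theta> (x - bary F x)) \<partial>\<mu>) \<le> (\<integral>\<^sup>+x. ennreal (\<theta> (x - bary G x)) \<partial>\<mu>)"
proof -
  define f where "f = (\<lambda>x. x - bary F x)"
  define w where "w = (\<lambda>x. x - bary G x)"
  have [measurable]: "bary F \<in> borel_measurable borel" "bary G \<in> borel_measurable borel"
    using integrable_bary[OF F] integrable_bary[OF G] by (auto dest!: borel_measurable_integrable)
  have f_borel [measurable]: "f \<in> borel_measurable borel" and w_borel [measurable]: "w \<in> borel_measurable borel"
    unfolding f_def w_def by measurable
  have f: "f \<in> borel_measurable \<mu>" using f_borel by simp
  define T where "T t x = bathtub (distr \<mu> borel f) (cdf \<nu> t) (f x)" for t x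
  have T: "T \<in> cond_cdfs"
    unfolding T_def using f_borel by (rule bathtub_in_cond_cdfs)
  have \<sigma>_meas: "\<sigma> \<in> borel_measurable borel"
    using \<sigma>(1) by (intro borel_measurable_mono strict_mono_mono)
  have \<sigma>f: "(\<lambda>x. \<sigma> (f x)) \<in> borel_measurable \<mu>"
    using f \<sigma>_meas by (rule measurable_compose)
  define D where "D t = (LINT x|\<mu>. \<sigma> (f x) * (F t x - T t x))" for t
  note wbd = weighted_bary_diff[OF F T \<sigma>f \<sigma>(2)]
  have D_nonneg: "AE t in lborel. 0 \<le> D t"
    using cond_cdfsD(5)[OF F]
  proof eventually_elim
    case (elim t)
    show ?case
      unfolding D_def T_def
      using mu.bathtub_optimal(1)[OF f \<sigma> cond_cdfs_integrable[OF F] _ _ elim] cond_cdfsD[OF F] by simp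
  qed
  \<comment> \<open>Testing stationarity with \<open>T\<close> bounds the integral of the deficits
    \<open>D t\<close> by 0. Almost every deficit is nonnegative, so almost every slice of
    \<open>F\<close> ties with the bathtub slice.\<close>
  have "(LINT t|lborel. D t) \<le> 0"
    using stat[OF T] wbd(2) by (simp add: D_def f_def)
  then have "AE t in lborel. D t = 0"
    using integral_nonneg_eq_0_iff_AE[of lborel D] wbd(1) D_nonneg integral_nonneg_AE[OF D_nonneg]
    by (auto simp: D_def[abs_def])
  then have slice: "AE t in lborel. 0 \<le> (LINT x|\<mu>. \<psi> (f x) * (G t x - F t x))"
    if "mono \<psi>" "\<And>s. \<bar>\<psi> s\<bar> \<le> C" for \<psi> C
    using cond_cdfsD(5)[OF F] cond_cdfsD(5)[OF G]
  proof eventually_elim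
    case (elim t)
    show ?case
      using mu.bathtub_optimal(2)[OF f \<sigma> cond_cdfs_integrable[OF F] _ _ elim(2) _ cond_cdfs_integrable[OF G] _ _ elim(3) that]
        cond_cdfsD[OF F] cond_cdfsD[OF G] elim(1) by (simp add: D_def T_def)
  qed
  have lin: "0 \<le> (LINT x|\<mu>. \<psi> (f x) * (bary F x - bary G x))"
    if "mono \<psi>" "\<And>s. \<bar>\<psi> s\<bar> \<le> C" for \<psi> C
  proof -
    have "(\<lambda>x. \<psi> (f x)) \<in> borel_measurable \<mu>"
      using f borel_measurable_mono[OF that(1)] by (rule measurable_compose)
    from weighted_bary_diff(2)[OF G F this that(2)] show ?thesis
      using integral_nonneg_AE[OF slice[OF that]] by simp
  qed
  have conv: "convex_on UNIV \<theta>" and even: "\<And>x. \<theta> (- x) = \<theta> x" and nonneg: "\<And>x. 0 \<le> \<theta> x" and zero: "\<theta> 0 = 0"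
    using \<theta> by (auto simp: cost_function_def)
  have "continuous_on UNIV \<theta>"
    using conv by (intro convex_on_continuous) auto
  then have [measurable]: "\<theta> \<in> borel_measurable borel"
    by (rule borel_measurable_continuous_onI)
  obtain g where g: "\<And>x y. \<theta> x + g x * (y - x) \<le> \<theta> y" and g_mono: "mono g"
    using convex_subgradient[OF conv] by metis
  \<comment> \<open>Clipping the argument makes \<open>g (K N s)\<close> bounded even if
    \<open>g\<close> is not. \<open>Suc N\<close> keeps the clipping bounds away from 0, so that the
    sign of \<open>g\<close> there is known.\<close>
  define K where "K N s = max (- real (Suc N)) (min (real (Suc N)) s)" for N s
  have g_sign: "0 \<le> g s" if "0 < s" for s
    using g[of s 0] nonneg[of s] zero that by (smt (verit) mult_neg_pos mult_minus_right)
  have g_sign': "g s \<le> 0" if "s < 0" for s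
    using g[of s 0] nonneg[of s] zero that by (smt (verit) mult_neg_neg mult_pos_neg mult_minus_right)
  have trunc: "(\<integral>\<^sup>+x. ennreal (\<theta> (K N (f x))) \<partial>\<mu>) \<le> (\<integral>\<^sup>+x. ennreal (\<theta> (w x)) \<partial>\<mu>)" for N
  proof (cases "(\<integral>\<^sup>+x. ennreal (\<theta> (w x)) \<partial>\<mu>) = \<infinity>")
    case False
    have K_bd: "- real (Suc N) \<le> K N s" "K N s \<le> real (Suc N)" for s
      by (auto simp: K_def)
    have \<psi>: "mono (\<lambda>s. g (K N s))"
      using g_mono by (auto simp: mono_def K_def)
    define C where "C = \<bar>g (- real (Suc N))\<bar> + \<bar>g (real (Suc N))\<bar>"
    have \<psi>_bd: "\<bar>g (K N s)\<bar> \<le> C" for s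
      using monoD[OF g_mono K_bd(1)[of s]] monoD[OF g_mono K_bd(2)[of s]] unfolding C_def by linarith
    have [measurable]: "K N \<in> borel_measurable borel"
      unfolding K_def by measurable
    have [measurable]: "g \<in> borel_measurable borel"
      using g_mono by (rule borel_measurable_mono)
    \<comment> \<open>The subgradient inequality at the clipped point survives with
      \<open>r - s\<close> in place of \<open>r - K N s\<close>: the discarded term is a product of
      factors of equal sign, because a cost function decreases up to 0 and increases
      afterwards.\<close>
    have point: "\<theta> (K N s) + g (K N s) * (r - s) \<le> \<theta> r" for s r
    proof -
      have "0 \<le> g (K N s) * (s - K N s)"
        using g_sign[of "real (Suc N)"] g_sign'[of "- real (Suc N)"]
        by (auto simp: K_def max_def min_def intro!: mult_nonneg_nonneg mult_nonpos_nonpos)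
      then show ?thesis
        using g[of "K N s" r] by (simp add: algebra_simps)
    qed
    have int_w: "integrable \<mu> (\<lambda>x. \<theta> (w x))"
      using False nonneg by (intro integrableI_nonneg) (auto simp: less_top)
    have int_g: "integrable \<mu> (\<lambda>x. g (K N (f x)) * (bary F x - bary G x))"
    proof (rule Bochner_Integration.integrable_bound)
      show "integrable \<mu> (\<lambda>x. C * (bary F x - bary G x))"
        using integrable_bary[OF F] integrable_bary[OF G] by simp
      show "(\<lambda>x. g (K N (f x)) * (bary F x - bary G x)) \<in> borel_measurable \<mu>"
        by simp
      show "AE x in \<mu>. norm (g (K N (f x)) * (bary F x - bary G x)) \<le> norm (C * (bary F x - bary G x))"
        using \<psi>_bd by (auto simp: abs_mult C_def intro!: mult_right_mono)
    qed
    have pw: "\<theta> (K N (f x)) + g (K N (f x)) * (bary F x - bary G x) \<le> \<theta> (w x)" for x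
      using point[of "f x" "w x"] by (simp add: w_def f_def)
    have int_K: "integrable \<mu> (\<lambda>x. \<theta> (K N (f x)))"
    proof (rule Bochner_Integration.integrable_bound)
      show "integrable \<mu> (\<lambda>x. \<theta> (w x) - g (K N (f x)) * (bary F x - bary G x))"
        using int_w int_g by simp
      show "(\<lambda>x. \<theta> (K N (f x))) \<in> borel_measurable \<mu>" by simp
      show "AE x in \<mu>. norm (\<theta> (K N (f x))) \<le> norm (\<theta> (w x) - g (K N (f x)) * (bary F x - bary G x))"
        using pw nonneg by (auto simp: le_diff_eq abs_of_nonneg intro!: order_trans[OF _ abs_ge_self])
    qed
    have "(LINT x|\<mu>. \<theta> (K N (f x))) \<le> (LINT x|\<mu>. \<theta> (K N (f x))) + (LINT x|\<mu>. g (K N (f x)) * (bary F x - bary G x))"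
      using lin[OF \<psi> \<psi>_bd] by simp
    also have "\<dots> = (LINT x|\<mu>. \<theta> (K N (f x)) + g (K N (f x)) * (bary F x - bary G x))"
      using int_K int_g by simp
    also have "\<dots> \<le> (LINT x|\<mu>. \<theta> (w x))"
      using int_K int_g int_w pw by (intro integral_mono) auto
    finally show ?thesis
      using int_K int_w nonneg by (simp add: nn_integral_eq_integral)
  qed simp
  have K_ev: "\<forall>\<^sub>F N in sequentially. K N s = s" for s
    using eventually_gt_at_top[of "nat \<lceil>\<bar>s\<bar>\<rceil>"]
  proof eventually_elim
    case (elim N)
    then have "\<bar>s\<bar> \<le> real N" by linarith
    then show ?case by (auto simp: K_def)
  qed
  \<comment> \<open>Finiteness of the cost of \<open>F\<close> is not known beforehand. Fatou's
    lemma removes the clipping, as \<open>K N s = s\<close> for large N.\<close>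
  have "(\<integral>\<^sup>+x. ennreal (\<theta> (f x)) \<partial>\<mu>) = (\<integral>\<^sup>+x. liminf (\<lambda>N. ennreal (\<theta> (K N (f x)))) \<partial>\<mu>)"
  proof (rule nn_integral_cong)
    fix x
    have "(\<lambda>N. ennreal (\<theta> (K N (f x)))) \<longlonglongrightarrow> ennreal (\<theta> (f x))"
      using K_ev[of "f x"] by (intro tendsto_eventually) (auto elim!: eventually_mono)
    then show "ennreal (\<theta> (f x)) = liminf (\<lambda>N. ennreal (\<theta> (K N (f x))))"
      by (simp add: lim_imp_Liminf)
  qed
  also have "\<dots> \<le> liminf (\<lambda>N. \<integral>\<^sup>+x. ennreal (\<theta> (K N (f x))) \<partial>\<mu>)"
    by (rule nn_integral_liminf) (simp add: K_def)
  also have "\<dots> \<le> (\<integral>\<^sup>+x. ennreal (\<theta> (w x)) \<partial>\<mu>)"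
    using trunc by (intro Liminf_le) auto
  finally show ?thesis by (simp add: f_def w_def)
qed

end

section \<open>Existence of a minimiser\<close>

definition smooth_abs :: "real \<Rightarrow> real" where "smooth_abs z = sqrt (1 + z\<^sup>2)"

definition smooth_sgn :: "real \<Rightarrow> real" where "smooth_sgn z = z / sqrt (1 + z\<^sup>2)"

lemma sqrt_1_plus_square_pos: "0 < sqrt (1 + (z::real)\<^sup>2)"
  by (simp add: add_pos_nonneg)

text \<open>Strict Cauchy-Schwarz for the vectors (1, w) and (1, z), which are parallel only if w =
  z: the tangent at z, evaluated at w, is their inner product divided by the norm of (1, z).\<close>

lemma smooth_abs_tangent_less:
  assumes "w \<noteq> z"
  shows "smooth_abs z + smooth_sgn z * (w - z) < smooth_abs w"
proof -
  have "(1 + w * z)\<^sup>2 < (1 + w\<^sup>2) * (1 + z\<^sup>2)"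
  proof -
    have "(1 + w\<^sup>2) * (1 + z\<^sup>2) - (1 + w * z)\<^sup>2 = (w - z)\<^sup>2"
      by (simp add: power2_eq_square algebra_simps)
    moreover have "0 < (w - z)\<^sup>2" using assms by simp
    ultimately show ?thesis by linarith
  qed
  then have "1 + w * z < sqrt ((1 + w\<^sup>2) * (1 + z\<^sup>2))"
    by (rule real_less_rsqrt)
  then have "(1 + w * z) / sqrt (1 + z\<^sup>2) < sqrt (1 + w\<^sup>2)"
    using sqrt_1_plus_square_pos[of z] by (simp add: real_sqrt_mult divide_less_eq)
  moreover have "smooth_abs z + smooth_sgn z * (w - z) = (1 + w * z) / sqrt (1 + z\<^sup>2)"
  proof -
    have "smooth_abs z = (1 + z\<^sup>2) / sqrt (1 + z\<^sup>2)"
      unfolding smooth_abs_def by (simp add: real_div_sqrt)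
    then show ?thesis
      by (simp add: smooth_sgn_def add_divide_distrib[symmetric] power2_eq_square algebra_simps)
  qed
  ultimately show ?thesis by (simp add: smooth_abs_def)
qed

lemma smooth_abs_tangent: "smooth_abs z + smooth_sgn z * (w - z) \<le> smooth_abs w"
  using smooth_abs_tangent_less[of w z] by (cases "w = z") auto

lemma strict_mono_smooth_sgn: "strict_mono smooth_sgn"
proof (rule strict_monoI)
  fix z w :: real assume "z < w"
  then have "(smooth_sgn z - smooth_sgn w) * (w - z) < 0"
    using smooth_abs_tangent_less[of w z] smooth_abs_tangent_less[of z w] by (simp add: algebra_simps)
  then show "smooth_sgn z < smooth_sgn w"
    using \<open>z < w\<close> by (simp add: mult_less_0_iff)
qed

lemma abs_smooth_sgn_le: "\<bar>smooth_sgn z\<bar> \<le> 1"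
  using sqrt_1_plus_square_pos[of z] by (simp add: smooth_sgn_def abs_divide divide_le_eq_1 real_le_rsqrt)

lemma smooth_abs_nonneg: "0 \<le> smooth_abs z"
  by (simp add: smooth_abs_def)

lemma smooth_abs_lipschitz: "\<bar>smooth_abs z - smooth_abs w\<bar> \<le> \<bar>z - w\<bar>"
proof -
  have *: "smooth_abs z - smooth_abs w \<le> \<bar>z - w\<bar>" for z w
  proof -
    have "smooth_abs z - smooth_abs w \<le> smooth_sgn z * (z - w)"
      using smooth_abs_tangent[of z w] by (simp add: algebra_simps)
    also have "\<dots> \<le> \<bar>smooth_sgn z\<bar> * \<bar>z - w\<bar>"
      by (metis abs_ge_self abs_mult)
    also have "\<dots> \<le> \<bar>z - w\<bar>"
      using abs_smooth_sgn_le[of z] by (simp add: mult_left_le_one_le)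
    finally show ?thesis .
  qed
  show ?thesis using *[of z w] *[of w z] by (simp add: abs_le_iff abs_minus_commute)
qed

lemma smooth_abs_le: "smooth_abs z \<le> 1 + \<bar>z\<bar>"
  using smooth_abs_lipschitz[of z 0] by (simp add: smooth_abs_def)

lemma smooth_abs_midpoint: "smooth_abs ((z + w) / 2) \<le> (smooth_abs z + smooth_abs w) / 2"
  using smooth_abs_tangent[of "(z + w) / 2" z] smooth_abs_tangent[of "(z + w) / 2" w]
  by (simp add: field_simps)

lemma smooth_abs_measurable [measurable]: "smooth_abs \<in> borel_measurable borel" "smooth_sgn \<in> borel_measurable borel"
  unfolding smooth_abs_def[abs_def] smooth_sgn_def[abs_def] by measurable

section \<open>Limits of couplings and minimisation of the auxiliary cost\<close>

context two_laws
begin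

lemma integrable_abs_diff_pair:
  assumes "F \<in> cond_cdfs" "G \<in> cond_cdfs"
  shows "integrable (lborel \<Otimes>\<^sub>M \<mu>) (\<lambda>(t, x). \<bar>F t x - G t x\<bar>)"
  using integrable_abs[OF integrable_diff_pair[OF assms]] by (simp add: case_prod_beta')

text \<open>A difference of means is at most the L1 distance of the distribution functions, which
  for genuine distribution functions is the 1-Wasserstein distance. So L1 convergence of conditional
  distribution functions carries over to barycentres.\<close>

lemma integral_abs_bary_diff_le:
  assumes "F \<in> cond_cdfs" "G \<in> cond_cdfs"
  shows "(LINT x|\<mu>. \<bar>bary F x - bary G x\<bar>) \<le> (LINT t|lborel. LINT x|\<mu>. \<bar>F t x - G t x\<bar>)"
proof -
  note int = integrable_abs_diff_pair[OF assms]
  have "(LINT x|\<mu>. \<bar>bary F x - bary G x\<bar>) \<le> (LINT x|\<mu>. LINT t|lborel. \<bar>F t x - G t x\<bar>)"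
  proof (rule integral_mono_AE)
    show "integrable \<mu> (\<lambda>x. \<bar>bary F x - bary G x\<bar>)"
      using integrable_bary assms by auto
    show "integrable \<mu> (\<lambda>x. LINT t|lborel. \<bar>F t x - G t x\<bar>)"
      using P.integrable_snd[OF int] by simp
    show "AE x in \<mu>. \<bar>bary F x - bary G x\<bar> \<le> (LINT t|lborel. \<bar>F t x - G t x\<bar>)"
      using bary_diff[OF assms]
    proof eventually_elim
      case (elim x)
      have "\<bar>bary F x - bary G x\<bar> = \<bar>LINT t|lborel. F t x - G t x\<bar>"
        by (simp add: elim[symmetric] abs_minus_commute)
      also have "\<dots> \<le> (LINT t|lborel. \<bar>F t x - G t x\<bar>)"
        by (rule integral_abs_bound)
      finally show ?case .
    qed
  qed
  also have "\<dots> = (LINT t|lborel. LINT x|\<mu>. \<bar>F t x - G t x\<bar>)"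
    using P.Fubini_integral[OF int] .
  finally show ?thesis .
qed

text \<open>Dominated convergence acts twice: over x with bound 1, which preserves the marginal, and
  over t with the majorant from \<open>integral_abs_step_minus\<close>, which is common to all
  couplings because the second marginal is fixed. The latter yields convergence of the
  barycentres.\<close>

lemma cond_cdfs_limit:
  assumes F: "\<And>n. F n \<in> cond_cdfs"
    and conv: "AE z in lborel \<Otimes>\<^sub>M \<mu>. convergent (\<lambda>n. F n (fst z) (snd z))"
  obtains L where "L \<in> cond_cdfs" "(\<lambda>n. LINT x|\<mu>. \<bar>bary (F n) x - bary L x\<bar>) \<longlonglongrightarrow> 0"
proof -
  \<comment> \<open>The lower limit exists also where the sequence diverges, so the bounds and the
    monotonicity in t hold at every point, as \<open>cond_cdfs\<close> demands.\<close>
  define L where "L t x = enn2real (liminf (\<lambda>n. ennreal (F n t x)))" for t x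
  have lim: "(\<lambda>n. F n t x) \<longlonglongrightarrow> L t x" if c: "convergent (\<lambda>n. F n t x)" for t x
  proof -
    obtain l where l: "(\<lambda>n. F n t x) \<longlonglongrightarrow> l" using c by (auto simp: convergent_def)
    moreover have "0 \<le> l"
      using l by (rule LIMSEQ_le_const) (use cond_cdfsD(2)[OF F] in auto)
    moreover have "liminf (\<lambda>n. ennreal (F n t x)) = ennreal l"
      using l by (intro lim_imp_Liminf tendsto_ennrealI) auto
    ultimately show ?thesis by (simp add: L_def)
  qed
  have le1: "liminf (\<lambda>n. ennreal (F n t x)) \<le> 1" for t x
    using cond_cdfsD(3)[OF F] by (intro Liminf_le) auto
  have L_bd: "0 \<le> L t x" "L t x \<le> 1" for t x
    using enn2real_mono[OF le1[of t x]] by (auto simp: L_def)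
  have L_mono: "L s x \<le> L t x" if "s \<le> t" for s t x
    unfolding L_def
  proof (rule enn2real_mono)
    show "liminf (\<lambda>n. ennreal (F n s x)) \<le> liminf (\<lambda>n. ennreal (F n t x))"
      using cond_cdfsD(4)[OF F that] by (intro Liminf_mono always_eventually allI ennreal_leI) auto
    show "liminf (\<lambda>n. ennreal (F n t x)) < \<top>"
      using le1[of t x] by (simp add: less_top[symmetric] top_unique) (metis ennreal_one_neq_top top_unique)
  qed
  have L_meas: "case_prod L \<in> borel_measurable (borel \<Otimes>\<^sub>M borel)"
  proof -
    have "(\<lambda>z. enn2real (liminf (\<lambda>n. ennreal (case_prod (F n) z)))) \<in> borel_measurable (borel \<Otimes>\<^sub>M borel)"
      using cond_cdfsD(1)[OF F] by measurable
    then show ?thesis by (simp add: L_def case_prod_beta')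
  qed
  have L_slice: "L t \<in> borel_measurable \<mu>" for t
  proof -
    have "L t \<in> borel_measurable borel" using L_meas by measurable
    then show ?thesis by simp
  qed
  have "AE t in lborel. AE x in \<mu>. convergent (\<lambda>n. F n t x)"
    using P.AE_pair[OF conv] by simp
  then have L1_slice: "AE t in lborel. (\<lambda>n. LINT x|\<mu>. \<bar>F n t x - L t x\<bar>) \<longlonglongrightarrow> 0"
  proof eventually_elim
    case (elim t)
    have "(\<lambda>n. LINT x|\<mu>. \<bar>F n t x - L t x\<bar>) \<longlonglongrightarrow> (LINT x|\<mu>. 0)"
    proof (rule integral_dominated_convergence[where w="\<lambda>_. 1"])
      show "AE x in \<mu>. (\<lambda>n. \<bar>F n t x - L t x\<bar>) \<longlonglongrightarrow> 0"
        using elim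
      proof eventually_elim
        case (elim x)
        then show ?case using tendsto_rabs[OF LIM_zero[OF lim]] by simp
      qed
      show "AE x in \<mu>. norm \<bar>F n t x - L t x\<bar> \<le> 1" for n
        using cond_cdfsD(2,3)[OF F, of n t] L_bd[of t] by (intro AE_I2) (smt (verit) real_norm_def)
    qed (use cond_cdfs_measurable(2)[OF F] L_slice in auto)
    then show ?case by simp
  qed
  have "AE t in lborel. \<forall>n. (LINT x|\<mu>. F n t x) = cdf \<nu> t"
    using cond_cdfsD(5)[OF F] by (simp add: AE_all_countable)
  with L1_slice have L_marg: "AE t in lborel. (LINT x|\<mu>. L t x) = cdf \<nu> t"
  proof eventually_elim
    case (elim t)
    have int: "integrable \<mu> (F n t)" "integrable \<mu> (L t)" for n
      using cond_cdfs_integrable[OF F] L_slice L_bd by (auto intro!: mu.integrable_const_bound[where B=1])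
    have "\<bar>LINT x|\<mu>. F n t x - L t x\<bar> \<le> (LINT x|\<mu>. \<bar>F n t x - L t x\<bar>)" for n
      by (rule integral_abs_bound)
    then have "\<bar>cdf \<nu> t - (LINT x|\<mu>. L t x)\<bar> \<le> (LINT x|\<mu>. \<bar>F n t x - L t x\<bar>)" for n
      using int elim(2) by simp
    then have "\<bar>cdf \<nu> t - (LINT x|\<mu>. L t x)\<bar> \<le> 0"
      using elim(1) by (intro LIMSEQ_le_const) auto
    then show ?case by simp
  qed
  have L: "L \<in> cond_cdfs"
    using L_meas L_bd L_mono L_marg by (auto simp: cond_cdfs_def)
  let ?k = "\<lambda>t. \<bar>indicat_real {0<..} t - cdf \<nu> t\<bar>"
  have L1: "(\<lambda>n. LINT t|lborel. LINT x|\<mu>. \<bar>F n t x - L t x\<bar>) \<longlonglongrightarrow> (LINT t|(lborel :: real measure). 0)"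
  proof (rule integral_dominated_convergence[where w="\<lambda>t. 2 * ?k t"])
    show "integrable lborel (\<lambda>t. 2 * ?k t)"
      using nu.integrable_step_minus_cdf[OF integrable_nu] by simp
    show "AE t in lborel. (\<lambda>n. LINT x|\<mu>. \<bar>F n t x - L t x\<bar>) \<longlonglongrightarrow> 0"
      by (rule L1_slice)
    show "(\<lambda>t. LINT x|\<mu>. \<bar>F n t x - L t x\<bar>) \<in> borel_measurable lborel" for n
      using P.integrable_fst[OF integrable_abs_diff_pair[OF F[of n] L]]
      by (auto dest: borel_measurable_integrable)
    show "AE t in lborel. norm (LINT x|\<mu>. \<bar>F n t x - L t x\<bar>) \<le> 2 * ?k t" for n
      using integral_abs_step_minus[OF F, of n] integral_abs_step_minus[OF L]
    proof eventually_elim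
      case (elim t)
      have int: "integrable \<mu> (F n t)" "integrable \<mu> (L t)"
        using cond_cdfs_integrable[OF F] cond_cdfs_integrable[OF L] by auto
      have "(LINT x|\<mu>. \<bar>F n t x - L t x\<bar>)
          \<le> (LINT x|\<mu>. \<bar>indicat_real {0<..} t - F n t x\<bar> + \<bar>indicat_real {0<..} t - L t x\<bar>)"
        using int by (intro integral_mono) auto
      also have "\<dots> = 2 * ?k t"
        using int elim by (subst Bochner_Integration.integral_add) auto
      finally show ?case by simp
    qed
  qed simp
  have "(\<lambda>n. LINT x|\<mu>. \<bar>bary (F n) x - bary L x\<bar>) \<longlonglongrightarrow> 0"
  proof (rule tendsto_sandwich[OF _ _ tendsto_const])
    show "(\<lambda>n. LINT t|lborel. LINT x|\<mu>. \<bar>F n t x - L t x\<bar>) \<longlonglongrightarrow> 0"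
      using L1 by simp
  qed (auto intro!: always_eventually integral_abs_bary_diff_le F L)
  with L show ?thesis by (rule that)
qed

definition smooth_cost :: "(real \<Rightarrow> real \<Rightarrow> real) \<Rightarrow> real" where
  "smooth_cost F = (LINT x|\<mu>. smooth_abs (x - bary F x))"

lemma bary_borel_measurable [measurable (raw)]: "F \<in> cond_cdfs \<Longrightarrow> bary F \<in> borel_measurable borel"
  using integrable_bary[of F] by (auto dest!: borel_measurable_integrable)

lemma integrable_smooth_cost:
  assumes "F \<in> cond_cdfs"
  shows "integrable \<mu> (\<lambda>x. smooth_abs (x - bary F x))"
proof (rule Bochner_Integration.integrable_bound)
  show "integrable \<mu> (\<lambda>x. 1 + \<bar>x - bary F x\<bar>)"
    using integrable_mu integrable_bary[OF assms] by simp
  have [measurable]: "bary F \<in> borel_measurable borel"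
    using assms by (rule bary_borel_measurable)
  show "(\<lambda>x. smooth_abs (x - bary F x)) \<in> borel_measurable \<mu>"
    by measurable
  show "AE x in \<mu>. norm (smooth_abs (x - bary F x)) \<le> norm (1 + \<bar>x - bary F x\<bar>)"
    using smooth_abs_le smooth_abs_nonneg by simp
qed

lemma smooth_cost_nonneg: "0 \<le> smooth_cost F"
  unfolding smooth_cost_def using smooth_abs_nonneg by (intro integral_nonneg_AE) auto

lemma smooth_cost_lipschitz:
  assumes "F \<in> cond_cdfs" "G \<in> cond_cdfs"
  shows "\<bar>smooth_cost F - smooth_cost G\<bar> \<le> (LINT x|\<mu>. \<bar>bary F x - bary G x\<bar>)"
proof -
  have "\<bar>smooth_cost F - smooth_cost G\<bar> = \<bar>LINT x|\<mu>. smooth_abs (x - bary F x) - smooth_abs (x - bary G x)\<bar>"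
    using integrable_smooth_cost[OF assms(1)] integrable_smooth_cost[OF assms(2)] by (simp add: smooth_cost_def)
  also have "\<dots> \<le> (LINT x|\<mu>. \<bar>smooth_abs (x - bary F x) - smooth_abs (x - bary G x)\<bar>)"
    by (rule integral_abs_bound)
  also have "\<dots> \<le> (LINT x|\<mu>. \<bar>bary F x - bary G x\<bar>)"
    using integrable_smooth_cost[OF assms(1)] integrable_smooth_cost[OF assms(2)] integrable_bary[OF assms(1)] integrable_bary[OF assms(2)]
      smooth_abs_lipschitz[of "x - bary F x" "x - bary G x" for x]
    by (intro integral_mono) (auto simp: abs_minus_commute)
  finally show ?thesis .
qed

text \<open>The coefficient \<open>1 - 1/2\<close> is left unevaluated so that the term is literally
  the instance \<open>s = 1/2\<close> of \<open>cond_cdfs_convex\<close>.\<close>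

abbreviation midpoint_fun :: "(real \<Rightarrow> real \<Rightarrow> real) \<Rightarrow> (real \<Rightarrow> real \<Rightarrow> real) \<Rightarrow> real \<Rightarrow> real \<Rightarrow> real" where
  "midpoint_fun F G \<equiv> (\<lambda>t x. (1 - 1/2) * F t x + (1/2) * G t x)"

lemma midpoint_in_cond_cdfs: "F \<in> cond_cdfs \<Longrightarrow> G \<in> cond_cdfs \<Longrightarrow> midpoint_fun F G \<in> cond_cdfs"
  by (rule cond_cdfs_convex) auto

lemma smooth_cost_midpoint:
  assumes "F \<in> cond_cdfs" "G \<in> cond_cdfs"
  shows "smooth_cost (midpoint_fun F G) \<le> (smooth_cost F + smooth_cost G) / 2"
proof -
  note int = integrable_smooth_cost[OF assms(1)] integrable_smooth_cost[OF assms(2)]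
  have "smooth_cost (midpoint_fun F G) \<le> (LINT x|\<mu>. (smooth_abs (x - bary F x) + smooth_abs (x - bary G x)) / 2)"
    unfolding smooth_cost_def
  proof (rule integral_mono_AE[OF integrable_smooth_cost[OF midpoint_in_cond_cdfs[OF assms]]])
    show "integrable \<mu> (\<lambda>x. (smooth_abs (x - bary F x) + smooth_abs (x - bary G x)) / 2)"
      using int by simp
    have "AE x in \<mu>. bary (midpoint_fun F G) x = (1 - 1/2) * bary F x + (1/2) * bary G x"
      using assms by (intro cond_cdfs_convex) auto
    then show "AE x in \<mu>. smooth_abs (x - bary (midpoint_fun F G) x) \<le> (smooth_abs (x - bary F x) + smooth_abs (x - bary G x)) / 2"
    proof eventually_elim
      case (elim x)
      have eq: "x - bary (midpoint_fun F G) x = ((x - bary F x) + (x - bary G x)) / 2"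
        unfolding elim by (simp add: field_simps)
      show ?case unfolding eq by (rule smooth_abs_midpoint)
    qed
  qed
  also have "\<dots> = (smooth_cost F + smooth_cost G) / 2"
    using int by (simp add: smooth_cost_def)
  finally show ?thesis .
qed

text \<open>A weight of total mass 1 makes bounded functions integrable over the line, and its
  positivity lets it be divided out of an almost everywhere limit.\<close>

abbreviation "W \<equiv> std_normal_density"

lemma integrable_W_mult:
  assumes "case_prod h \<in> borel_measurable (borel \<Otimes>\<^sub>M borel)" "\<And>t x. \<bar>h t x\<bar> \<le> 1"
  shows "integrable (lborel \<Otimes>\<^sub>M \<mu>) (\<lambda>(t, x). W t * h t x)"
proof (rule Bochner_Integration.integrable_bound)
  show "integrable (lborel \<Otimes>\<^sub>M \<mu>) (\<lambda>(t, x). W t)"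
  proof (rule P.Fubini_integrable)
    show "(\<lambda>(t, x). W t) \<in> borel_measurable (lborel \<Otimes>\<^sub>M \<mu>)"
      by (simp add: case_prod_beta')
    show "integrable lborel (\<lambda>t. LINT x|\<mu>. norm (case (t, x) of (t, x) \<Rightarrow> W t))"
      using mu.prob_space by simp
  qed simp
  have "(\<lambda>(t, x). W t * h t x) \<in> borel_measurable (borel \<Otimes>\<^sub>M borel)"
    using assms(1) by measurable
  then show "(\<lambda>(t, x). W t * h t x) \<in> borel_measurable (lborel \<Otimes>\<^sub>M \<mu>)"
    unfolding borel_measurable_pair_iff .
  show "AE z in lborel \<Otimes>\<^sub>M \<mu>. norm (case z of (t, x) \<Rightarrow> W t * h t x) \<le> norm (case z of (t, x) \<Rightarrow> W t)"
    using assms(2) by (auto simp: abs_mult mult_left_le split: prod.split)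
qed

lemma integral_W: "integral\<^sup>L (lborel \<Otimes>\<^sub>M \<mu>) (\<lambda>(t, x). W t) = 1"
proof -
  have "integral\<^sup>L (lborel \<Otimes>\<^sub>M \<mu>) (\<lambda>(t, x). W t) = (LINT t|lborel. LINT x|\<mu>. W t)"
    using P.integral_fst[of "\<lambda>t x. W t"] integrable_W_mult[of "\<lambda>_ _. 1"] by simp
  then show ?thesis using mu.prob_space by simp
qed

text \<open>\<open>smooth_cost\<close> sees a coupling only through its barycentres, so its
  minimising sequences need not converge as conditional distribution functions. This weighted
  squared L2 norm depends on all of \<open>F\<close> and serves as a selection criterion.\<close>

definition energy :: "(real \<Rightarrow> real \<Rightarrow> real) \<Rightarrow> real" where
  "energy F = integral\<^sup>L (lborel \<Otimes>\<^sub>M \<mu>) (\<lambda>(t, x). W t * (F t x)\<^sup>2)"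

lemma integrable_energy:
  assumes "F \<in> cond_cdfs"
  shows "integrable (lborel \<Otimes>\<^sub>M \<mu>) (\<lambda>(t, x). W t * (F t x)\<^sup>2)"
proof (rule integrable_W_mult)
  show "(\<lambda>(t, x). (F t x)\<^sup>2) \<in> borel_measurable (borel \<Otimes>\<^sub>M borel)"
    using cond_cdfsD(1)[OF assms] by measurable
qed (use cond_cdfsD[OF assms] in \<open>auto simp: power_le_one\<close>)

lemma integrable_energy_diff:
  assumes "F \<in> cond_cdfs" "G \<in> cond_cdfs"
  shows "integrable (lborel \<Otimes>\<^sub>M \<mu>) (\<lambda>(t, x). W t * (F t x - G t x)\<^sup>2)"
proof (rule integrable_W_mult)
  show "(\<lambda>(t, x). (F t x - G t x)\<^sup>2) \<in> borel_measurable (borel \<Otimes>\<^sub>M borel)"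
    using cond_cdfsD(1)[OF assms(1)] cond_cdfsD(1)[OF assms(2)] by measurable
  show "\<bar>(F t x - G t x)\<^sup>2\<bar> \<le> 1" for t x
    using cond_cdfsD(2,3)[OF assms(1), of t x] cond_cdfsD(2,3)[OF assms(2), of t x]
    by (simp add: abs_square_le_1 abs_le_iff)
qed

lemma energy_bounds:
  assumes "F \<in> cond_cdfs"
  shows "0 \<le> energy F" "energy F \<le> 1"
proof -
  show "0 \<le> energy F"
    unfolding energy_def by (intro integral_nonneg_AE) auto
  have "energy F \<le> integral\<^sup>L (lborel \<Otimes>\<^sub>M \<mu>) (\<lambda>(t, x). W t)"
    unfolding energy_def
  proof (rule integral_mono[OF integrable_energy[OF assms]])
    show "integrable (lborel \<Otimes>\<^sub>M \<mu>) (\<lambda>(t, x). W t)"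
      using integrable_W_mult[of "\<lambda>_ _. 1"] by simp
  qed (use cond_cdfsD[OF assms] in \<open>auto simp: power_le_one mult_left_le split: prod.split\<close>)
  then show "energy F \<le> 1" by (simp add: integral_W)
qed

lemma energy_parallelogram:
  assumes "F \<in> cond_cdfs" "G \<in> cond_cdfs"
  shows "integral\<^sup>L (lborel \<Otimes>\<^sub>M \<mu>) (\<lambda>(t, x). W t * (F t x - G t x)\<^sup>2)
    = 2 * energy F + 2 * energy G - 4 * energy (midpoint_fun F G)"
proof -
  note int = integrable_energy[OF assms(1)] integrable_energy[OF assms(2)]
    integrable_energy[OF midpoint_in_cond_cdfs[OF assms]]
  have "2 * energy F + 2 * energy G - 4 * energy (midpoint_fun F G)
    = integral\<^sup>L (lborel \<Otimes>\<^sub>M \<mu>) (\<lambda>z. 2 * (case z of (t, x) \<Rightarrow> W t * (F t x)\<^sup>2)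
        + 2 * (case z of (t, x) \<Rightarrow> W t * (G t x)\<^sup>2)
        - 4 * (case z of (t, x) \<Rightarrow> W t * (midpoint_fun F G t x)\<^sup>2))"
    unfolding energy_def using int
    by (subst Bochner_Integration.integral_diff Bochner_Integration.integral_add; simp)+
  also have "\<dots> = integral\<^sup>L (lborel \<Otimes>\<^sub>M \<mu>) (\<lambda>(t, x). W t * (F t x - G t x)\<^sup>2)"
    by (intro Bochner_Integration.integral_cong)
       (auto simp: power2_eq_square field_simps split: prod.split)
  finally show ?thesis by simp
qed

text \<open>Integrated form of \<open>\<bar>d\<bar> \<le> \<delta> + d\<^sup>2 / \<delta>\<close>.
  It stands in for Cauchy-Schwarz in passing from an L2 to an L1 Cauchy property.\<close>

lemma integral_W_abs_diff_le:
  assumes "F \<in> cond_cdfs" "G \<in> cond_cdfs" and \<delta>: "0 < \<delta>"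
  shows "integral\<^sup>L (lborel \<Otimes>\<^sub>M \<mu>) (\<lambda>(t, x). W t * \<bar>F t x - G t x\<bar>)
    \<le> \<delta> + integral\<^sup>L (lborel \<Otimes>\<^sub>M \<mu>) (\<lambda>(t, x). W t * (F t x - G t x)\<^sup>2) / \<delta>"
proof -
  have int1: "integrable (lborel \<Otimes>\<^sub>M \<mu>) (\<lambda>(t, x). W t)"
    using integrable_W_mult[of "\<lambda>_ _. 1"] by simp
  note int2 = integrable_energy_diff[OF assms(1,2)]
  have int3: "integrable (lborel \<Otimes>\<^sub>M \<mu>) (\<lambda>(t, x). W t * \<bar>F t x - G t x\<bar>)"
  proof (rule integrable_W_mult)
    show "(\<lambda>(t, x). \<bar>F t x - G t x\<bar>) \<in> borel_measurable (borel \<Otimes>\<^sub>M borel)"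
      using cond_cdfsD(1)[OF assms(1)] cond_cdfsD(1)[OF assms(2)] by measurable
    show "\<bar>\<bar>F t x - G t x\<bar>\<bar> \<le> 1" for t x
      using cond_cdfsD(2,3)[OF assms(1), of t x] cond_cdfsD(2,3)[OF assms(2), of t x] by simp
  qed
  have am: "\<bar>d\<bar> \<le> \<delta> + d\<^sup>2 / \<delta>" for d
  proof (cases "\<bar>d\<bar> \<le> \<delta>")
    case True
    then show ?thesis using \<delta> by (smt (verit) divide_nonneg_pos zero_le_power2)
  next
    case False
    then have "\<bar>d\<bar> * \<delta> \<le> d\<^sup>2"
      using \<delta> by (metis abs_ge_zero linear mult_left_mono power2_abs power2_eq_square)
    then show ?thesis using \<delta> by (simp add: field_simps) (smt (verit) mult_pos_pos)
  qed
  have "integral\<^sup>L (lborel \<Otimes>\<^sub>M \<mu>) (\<lambda>(t, x). W t * \<bar>F t x - G t x\<bar>)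
    \<le> integral\<^sup>L (lborel \<Otimes>\<^sub>M \<mu>) (\<lambda>z. \<delta> * (case z of (t, x) \<Rightarrow> W t)
        + (case z of (t, x) \<Rightarrow> W t * (F t x - G t x)\<^sup>2) / \<delta>)"
  proof (rule integral_mono[OF int3])
    show "integrable (lborel \<Otimes>\<^sub>M \<mu>) (\<lambda>z. \<delta> * (case z of (t, x) \<Rightarrow> W t)
        + (case z of (t, x) \<Rightarrow> W t * (F t x - G t x)\<^sup>2) / \<delta>)"
      using int1 int2 by simp
    fix z :: "real \<times> real"
    obtain t x where z: "z = (t, x)" by (cases z)
    have "W t * \<bar>F t x - G t x\<bar> \<le> W t * (\<delta> + (F t x - G t x)\<^sup>2 / \<delta>)"
      using am by (intro mult_left_mono) auto
    then show "(case z of (t, x) \<Rightarrow> W t * \<bar>F t x - G t x\<bar>) \<le> \<delta> * (case z of (t, x) \<Rightarrow> W t)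
        + (case z of (t, x) \<Rightarrow> W t * (F t x - G t x)\<^sup>2) / \<delta>"
      by (simp add: z algebra_simps)
  qed
  also have "\<dots> = \<delta> + integral\<^sup>L (lborel \<Otimes>\<^sub>M \<mu>) (\<lambda>(t, x). W t * (F t x - G t x)\<^sup>2) / \<delta>"
    using int1 int2 by (subst Bochner_Integration.integral_add) (auto simp: integral_W)
  finally show ?thesis .
qed

lemma cond_cdfs_nonempty: "cond_cdfs \<noteq> {}"
  using bathtub_in_cond_cdfs[of "\<lambda>x. x"] by auto

text \<open>Among the almost minimisers of \<^const>\<open>smooth_cost\<close>, take almost minimisers of the uniformly convex
  \<^const>\<open>energy\<close>: by the parallelogram law these form a Cauchy sequence.\<close>

lemma smooth_cost_minimiser_exists: "\<exists>F\<in>cond_cdfs. \<forall>G\<in>cond_cdfs. smooth_cost F \<le> smooth_cost G"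
proof -
  define j where "j = Inf (smooth_cost ` cond_cdfs)"
  have smooth_cost_bdd: "bdd_below (smooth_cost ` cond_cdfs)"
    using smooth_cost_nonneg by (intro bdd_belowI2[of _ 0]) auto
  have j_le: "j \<le> smooth_cost G" if "G \<in> cond_cdfs" for G
    unfolding j_def using smooth_cost_bdd that by (rule cINF_lower)
  define C where "C n = {F \<in> cond_cdfs. smooth_cost F \<le> j + inverse (real (Suc n))}" for n
  have C_ne: "C n \<noteq> {}" for n
  proof -
    have "\<exists>F\<in>cond_cdfs. smooth_cost F < j + inverse (real (Suc n))"
      using cINF_less_iff[OF cond_cdfs_nonempty smooth_cost_bdd, of "j + inverse (real (Suc n))"]
      by (simp add: j_def)
    then show ?thesis by (auto simp: C_def intro: less_imp_le)
  qed
  have C_anti: "C m \<subseteq> C n" if "n \<le> m" for n m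
  proof -
    have "inverse (real (Suc m)) \<le> inverse (real (Suc n))" using that by simp
    then have "smooth_cost F \<le> j + inverse (real (Suc m)) \<Longrightarrow> smooth_cost F \<le> j + inverse (real (Suc n))" for F
      by linarith
    then show ?thesis unfolding C_def by blast
  qed
  have C_mid: "midpoint_fun F G \<in> C n" if "F \<in> C n" "G \<in> C n" for F G n
    using that smooth_cost_midpoint[of F G] midpoint_in_cond_cdfs[of F G] by (auto simp: C_def)
  define v where "v n = Inf (energy ` C n)" for n
  have bdd: "bdd_below (energy ` C n)" for n
    using energy_bounds by (intro bdd_belowI2[of _ 0]) (auto simp: C_def)
  have v_le: "v n \<le> energy F" if "F \<in> C n" for F n
    unfolding v_def using bdd that by (rule cINF_lower)
  have "\<exists>F\<in>C n. energy F < v n + inverse (real (Suc n))" for n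
    using cINF_less_iff[OF C_ne bdd, of n "v n + inverse (real (Suc n))"] by (simp add: v_def)
  then obtain p where p: "\<And>n. p n \<in> C n" "\<And>n. energy (p n) < v n + inverse (real (Suc n))"
    by metis
  have pK: "p n \<in> cond_cdfs" for n using p(1) by (auto simp: C_def)
  have v_inc: "incseq v"
    unfolding v_def by (intro incseq_SucI cINF_superset_mono C_ne bdd C_anti) auto
  have "v n \<le> 1" for n
    using v_le[OF p(1)] energy_bounds(2)[OF pK] by (rule order_trans)
  then obtain V where V: "v \<longlonglongrightarrow> V" "\<And>n. v n \<le> V"
    using incseq_convergent[OF v_inc] by blast
  define E where "E F G = integral\<^sup>L (lborel \<Otimes>\<^sub>M \<mu>) (\<lambda>(t, x). W t * (F t x - G t x)\<^sup>2)" for F G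
  \<comment> \<open>The midpoint lies in \<open>C n\<close>, which contains \<open>C m\<close>, so
    its energy is at least \<open>v n\<close>. The parallelogram law then leaves
    \<open>2 * (v m - v n)\<close>, at most \<open>2 * (V - v n)\<close>, plus two tolerances of at
    most \<open>2 * inverse (real (Suc n))\<close> each.\<close>
  have E_le': "E (p n) (p m) \<le> 2 * (V - v n) + 4 * inverse (real (Suc n))" if "n \<le> m" for n m
  proof -
    have "v n \<le> energy (midpoint_fun (p n) (p m))"
      using C_mid[of "p n" n "p m"] p(1) C_anti[OF that] by (intro v_le) auto
    moreover have "inverse (real (Suc m)) \<le> inverse (real (Suc n))" using that by simp
    ultimately show ?thesis
      using energy_parallelogram[OF pK pK, of n m] p(2)[of n] p(2)[of m] V(2)[of m]
      unfolding E_def right_diff_distrib by linarith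
  qed
  have E_sym: "E F G = E G F" for F G
    by (simp add: E_def power2_commute)
  have "(\<lambda>n. 2 * (V - v n) + 4 * inverse (real (Suc n))) \<longlonglongrightarrow> 2 * (V - V) + 4 * 0"
    by (intro tendsto_intros V LIMSEQ_inverse_real_of_nat)
  then have E_lim: "(\<lambda>n. 2 * (V - v n) + 4 * inverse (real (Suc n))) \<longlonglongrightarrow> 0" by simp
  define s where "s n = (\<lambda>(t, x). W t * p n t x)" for n
  have s_int: "integrable (lborel \<Otimes>\<^sub>M \<mu>) (s n)" for n
    unfolding s_def using cond_cdfsD(1-3)[OF pK] by (intro integrable_W_mult) auto
  have s_norm: "(LINT z|(lborel \<Otimes>\<^sub>M \<mu>). norm (s i z - s k z))
      = integral\<^sup>L (lborel \<Otimes>\<^sub>M \<mu>) (\<lambda>(t, x). W t * \<bar>p i t x - p k t x\<bar>)" for i k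
    by (intro Bochner_Integration.integral_cong)
       (auto simp: s_def right_diff_distrib[symmetric] abs_mult)
  have "\<exists>N. \<forall>i\<ge>N. \<forall>k\<ge>N. (LINT z|(lborel \<Otimes>\<^sub>M \<mu>). norm (s i z - s k z)) < e" if "0 < e" for e
  proof -
    \<comment> \<open>Once the squared distance is below \<open>\<delta>\<^sup>2\<close>, the bound
      of \<open>integral_W_abs_diff_le\<close> is below \<open>2 * \<delta>\<close>, hence below
      \<open>e\<close>.\<close>
    define \<delta> where "\<delta> = e / 3"
    have \<delta>: "0 < \<delta>" using that by (simp add: \<delta>_def)
    obtain N where N: "\<And>n. N \<le> n \<Longrightarrow> 2 * (V - v n) + 4 * inverse (real (Suc n)) < \<delta>\<^sup>2"
      using order_tendstoD(2)[OF E_lim, of "\<delta>\<^sup>2"] \<delta> by (auto simp: eventually_sequentially)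
    show ?thesis
    proof (intro exI allI impI)
      fix i k assume ik: "N \<le> i" "N \<le> k"
      have "E (p i) (p k) < \<delta>\<^sup>2"
      proof (cases "i \<le> k")
        case True
        then show ?thesis using E_le'[of i k] N[OF ik(1)] by linarith
      next
        case False
        then show ?thesis using E_le'[of k i] N[OF ik(2)] E_sym[of "p i" "p k"] by linarith
      qed
      then have "E (p i) (p k) / \<delta> < \<delta>"
        using \<delta> by (simp add: divide_less_eq power2_eq_square)
      then show "(LINT z|(lborel \<Otimes>\<^sub>M \<mu>). norm (s i z - s k z)) < e"
        using integral_W_abs_diff_le[OF pK pK \<delta>, of i k] \<delta> unfolding s_norm E_def by (simp add: \<delta>_def)
    qed
  qed
  then obtain r where r: "strict_mono r" "AE z in lborel \<Otimes>\<^sub>M \<mu>. Cauchy (\<lambda>i. s (r i) z)"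
    using cauchy_L1_AE_cauchy_subseq[of "lborel \<Otimes>\<^sub>M \<mu>" s, OF s_int] by blast
  have "AE z in lborel \<Otimes>\<^sub>M \<mu>. convergent (\<lambda>i. p (r i) (fst z) (snd z))"
    using r(2)
  proof eventually_elim
    case (elim z)
    then have "convergent (\<lambda>i. W (fst z) * p (r i) (fst z) (snd z))"
      by (simp add: s_def case_prod_beta' Cauchy_convergent_iff)
    moreover have "W (fst z) \<noteq> 0"
      using normal_density_pos[of 1 0 "fst z"] by simp
    ultimately show ?case
      by (simp add: convergent_mult_const_iff)
  qed
  then obtain L where L: "L \<in> cond_cdfs" "(\<lambda>i. LINT x|\<mu>. \<bar>bary (p (r i)) x - bary L x\<bar>) \<longlonglongrightarrow> 0"
    using cond_cdfs_limit[of "\<lambda>i. p (r i)"] pK by blast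
  have "smooth_cost L \<le> j + inverse (real (Suc i)) + (LINT x|\<mu>. \<bar>bary (p (r i)) x - bary L x\<bar>)" for i
  proof -
    have "inverse (real (Suc (r i))) \<le> inverse (real (Suc i))"
      using seq_suble[OF r(1), of i] by simp
    moreover have "smooth_cost (p (r i)) \<le> j + inverse (real (Suc (r i)))"
      using p(1) by (auto simp: C_def)
    ultimately show ?thesis
      using smooth_cost_lipschitz[OF pK L(1), of "r i"] by linarith
  qed
  moreover have "(\<lambda>i. j + inverse (real (Suc i)) + (LINT x|\<mu>. \<bar>bary (p (r i)) x - bary L x\<bar>)) \<longlonglongrightarrow> j + 0 + 0"
    by (intro tendsto_intros L(2) LIMSEQ_inverse_real_of_nat)
  ultimately have "smooth_cost L \<le> j"
    using LIMSEQ_le_const by fastforce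
  then show ?thesis
    using L(1) j_le by force
qed

text \<open>First variation along the segment from \<open>F\<close> to \<open>G\<close>. The tangent
  is taken at the displaced point \<open>f x - s * d x\<close> and not at \<open>f x\<close>, so
  minimality gives an exact inequality for each s; only an integrand dominated by
  \<open>\<bar>d x\<bar>\<close> has to pass to the limit as s tends to 0.\<close>

lemma smooth_cost_minimiser_stationary:
  assumes F: "F \<in> cond_cdfs" and min: "\<And>G. G \<in> cond_cdfs \<Longrightarrow> smooth_cost F \<le> smooth_cost G"
    and G: "G \<in> cond_cdfs"
  shows "(LINT x|\<mu>. smooth_sgn (x - bary F x) * (bary G x - bary F x)) \<le> 0"
proof -
  define d where "d = (\<lambda>x. bary G x - bary F x)"
  define f where "f = (\<lambda>x. x - bary F x)"
  have [measurable]: "bary F \<in> borel_measurable borel" "bary G \<in> borel_measurable borel"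
    using F G by (auto intro: bary_borel_measurable)
  have d_int: "integrable \<mu> d"
    unfolding d_def using integrable_bary[OF F] integrable_bary[OF G] by simp
  have [measurable]: "d \<in> borel_measurable borel" "f \<in> borel_measurable borel"
    unfolding d_def f_def by measurable
  have bd: "\<bar>smooth_sgn z * y\<bar> \<le> \<bar>y\<bar>" for z y
    using abs_smooth_sgn_le[of z] by (simp add: abs_mult mult_left_le_one_le)
  have int: "integrable \<mu> (\<lambda>x. smooth_sgn (f x - s * d x) * d x)" for s
    using bd by (intro Bochner_Integration.integrable_bound[OF d_int]) auto
  have neg: "(LINT x|\<mu>. smooth_sgn (f x - s * d x) * d x) \<le> 0" if s: "0 < s" "s \<le> 1" for s
  proof -
    define H where "H = (\<lambda>t x. (1 - s) * F t x + s * G t x)"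
    have H: "H \<in> cond_cdfs" and H_bary: "AE x in \<mu>. bary H x = (1 - s) * bary F x + s * bary G x"
      unfolding H_def using F G s by (auto intro: cond_cdfs_convex)
    have "AE x in \<mu>. smooth_abs (x - bary H x) + s * (smooth_sgn (f x - s * d x) * d x) \<le> smooth_abs (x - bary F x)"
      using H_bary
    proof eventually_elim
      case (elim x)
      have eq: "x - bary H x = f x - s * d x"
        unfolding elim f_def d_def by (simp add: algebra_simps)
      have "smooth_abs (f x - s * d x) + smooth_sgn (f x - s * d x) * (s * d x) \<le> smooth_abs (f x)"
        using smooth_abs_tangent[of "f x - s * d x" "f x"] by simp
      then show ?case
        unfolding eq by (simp add: f_def mult.left_commute)
    qed
    then have "(LINT x|\<mu>. smooth_abs (x - bary H x) + s * (smooth_sgn (f x - s * d x) * d x)) \<le> smooth_cost F"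
      unfolding smooth_cost_def using integrable_smooth_cost[OF F] integrable_smooth_cost[OF H] int by (intro integral_mono_AE) auto
    then have "smooth_cost H + s * (LINT x|\<mu>. smooth_sgn (f x - s * d x) * d x) \<le> smooth_cost F"
      using integrable_smooth_cost[OF H] int by (simp add: smooth_cost_def)
    with min[OF H] have "s * (LINT x|\<mu>. smooth_sgn (f x - s * d x) * d x) \<le> 0" by linarith
    then show ?thesis using s by (simp add: mult_le_0_iff)
  qed
  have cont: "isCont smooth_sgn z" for z
    unfolding smooth_sgn_def[abs_def] using sqrt_1_plus_square_pos[of z]
    by (intro continuous_intros) auto
  have "(\<lambda>n. LINT x|\<mu>. smooth_sgn (f x - inverse (real (Suc n)) * d x) * d x) \<longlonglongrightarrow> (LINT x|\<mu>. smooth_sgn (f x) * d x)"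
  proof (rule integral_dominated_convergence[where w="\<lambda>x. \<bar>d x\<bar>"])
    show "AE x in \<mu>. (\<lambda>n. smooth_sgn (f x - inverse (real (Suc n)) * d x) * d x) \<longlonglongrightarrow> smooth_sgn (f x) * d x"
    proof (intro AE_I2 tendsto_mult tendsto_const isCont_tendsto_compose[OF cont])
      fix x
      have "(\<lambda>n. f x - inverse (real (Suc n)) * d x) \<longlonglongrightarrow> f x - 0 * d x"
        by (intro tendsto_intros LIMSEQ_inverse_real_of_nat)
      then show "(\<lambda>n. f x - inverse (real (Suc n)) * d x) \<longlonglongrightarrow> f x" by simp
    qed
    show "AE x in \<mu>. norm (smooth_sgn (f x - inverse (real (Suc n)) * d x) * d x) \<le> \<bar>d x\<bar>" for n
      using bd by simp
  qed (use d_int in auto)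
  moreover have "(LINT x|\<mu>. smooth_sgn (f x - inverse (real (Suc n)) * d x) * d x) \<le> 0" for n
    by (rule neg) (auto simp: inverse_le_1_iff)
  ultimately have "(LINT x|\<mu>. smooth_sgn (f x) * d x) \<le> 0"
    by (intro LIMSEQ_le_const2) auto
  then show ?thesis by (simp add: f_def d_def)
qed

lemma universal_minimiser_exists:
  "\<exists>F\<in>cond_cdfs. \<forall>G\<in>cond_cdfs. \<forall>\<theta>. cost_function \<theta> \<longrightarrow>
    (\<integral>\<^sup>+x. ennreal (\<theta> (x - bary F x)) \<partial>\<mu>) \<le> (\<integral>\<^sup>+x. ennreal (\<theta> (x - bary G x)) \<partial>\<mu>)"
proof -
  obtain F where F: "F \<in> cond_cdfs" "\<And>G. G \<in> cond_cdfs \<Longrightarrow> smooth_cost F \<le> smooth_cost G"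
    using smooth_cost_minimiser_exists by blast
  then show ?thesis
    using stationary_imp_optimal[OF F(1) _ strict_mono_smooth_sgn abs_smooth_sgn_le smooth_cost_minimiser_stationary[OF F]]
    by blast
qed

end

section \<open>Kernels and conditional distribution functions\<close>

text \<open>Nonempty open intervals have positive Lebesgue measure.\<close>

lemma AE_lborel_exists_between:
  fixes s t :: real
  assumes "AE u in lborel. Q u" "s < t"
  obtains u where "s < u" "u < t" "Q u"
proof -
  have "\<not> (AE u in lborel. u \<notin> {s<..<t})"
  proof
    assume "AE u in lborel. u \<notin> {s<..<t}"
    then have "emeasure lborel {s<..<t} = 0"
      by (subst (asm) AE_iff_null_sets[symmetric]) (auto simp: null_sets_def)
    then show False using assms(2) by simp
  qed
  moreover have "AE u in lborel. u \<notin> {s<..<t}" if none: "\<forall>u\<in>{s<..<t}. \<not> Q u"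
    using assms(1) by eventually_elim (use none in auto)
  ultimately show ?thesis using that by (meson greaterThanLessThan_iff)
qed

text \<open>For monotone \<open>H\<close> this is the right limit. Taking the infimum along a
  sequence keeps it countable, hence measurable in a parameter.\<close>

definition right_lim :: "(real \<Rightarrow> real) \<Rightarrow> real \<Rightarrow> real" where
  "right_lim H t = (INF n. H (t + inverse (real (Suc n))))"

context
  fixes H :: "real \<Rightarrow> real"
  assumes mono: "mono H" and bounds: "\<And>t. 0 \<le> H t" "\<And>t. H t \<le> 1"
begin

lemma right_lim_bdd: "bdd_below (range (\<lambda>n. H (t + inverse (real (Suc n)))))"
  using bounds by (intro bdd_belowI2[of _ 0]) auto

lemma le_right_lim: "H t \<le> right_lim H t"
  unfolding right_lim_def by (intro cINF_greatest monoD[OF mono]) auto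

lemma right_lim_le:
  assumes "s < t"
  shows "right_lim H s \<le> H t"
proof -
  obtain n where "inverse (real (Suc n)) < t - s"
    using reals_Archimedean[of "t - s"] assms by auto
  then have "H (s + inverse (real (Suc n))) \<le> H t"
    by (intro monoD[OF mono]) simp
  then show ?thesis
    unfolding right_lim_def by (intro cINF_lower2[OF right_lim_bdd]) auto
qed

lemma right_lim_mono: "s \<le> t \<Longrightarrow> right_lim H s \<le> right_lim H t"
  using right_lim_le[of s t] le_right_lim[of t] by (cases "s = t") auto

lemma right_lim_right_continuous: "continuous (at_right a) (right_lim H)"
  unfolding continuous_within
proof (rule order_tendstoI)
  fix y assume "y < right_lim H a"
  then have "y < right_lim H t" if "a < t" for t
    using right_lim_mono[of a t] that by simp
  then show "\<forall>\<^sub>F t in at_right a. y < right_lim H t"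
    by (auto simp: eventually_at_filter intro!: always_eventually)
next
  fix y assume "right_lim H a < y"
  then obtain n where n: "H (a + inverse (real (Suc n))) < y"
    unfolding right_lim_def using cINF_less_iff[OF _ right_lim_bdd] by auto
  have "right_lim H t < y" if "a < t" "t < a + inverse (real (Suc n))" for t
    using right_lim_le[OF that(2)] n by linarith
  then show "\<forall>\<^sub>F t in at_right a. right_lim H t < y"
    unfolding eventually_at_right_field by (intro exI[of _ "a + inverse (real (Suc n))"]) simp
qed

lemma right_lim_at_top:
  assumes "(\<lambda>k. H (real k)) \<longlonglongrightarrow> 1"
  shows "(right_lim H \<longlongrightarrow> 1) at_top"
proof (rule tendsto_at_topI_sequentially_real)
  show "mono (right_lim H)" using right_lim_mono by (rule monoI)
  show "(\<lambda>k. right_lim H (real k)) \<longlonglongrightarrow> 1"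
  proof (rule tendsto_sandwich[OF _ _ assms tendsto_const])
    show "\<forall>\<^sub>F k in sequentially. right_lim H (real k) \<le> 1"
      using right_lim_le[of t "t + 1" for t] bounds(2) by (intro always_eventually) (auto intro: order_trans)
  qed (use le_right_lim in auto)
qed

lemma right_lim_at_bot:
  assumes "(\<lambda>k. H (- real k)) \<longlonglongrightarrow> 0"
  shows "(right_lim H \<longlongrightarrow> 0) at_bot"
proof (rule order_tendstoI)
  fix y :: real assume "y < 0"
  then show "\<forall>\<^sub>F t in at_bot. y < right_lim H t"
    using le_right_lim bounds(1) by (intro always_eventually allI) (meson less_le_trans)
next
  fix y :: real assume "0 < y"
  then obtain k where k: "H (- real k) < y"
    using order_tendstoD(2)[OF assms] by (auto simp: eventually_sequentially)
  have "right_lim H t < y" if "t \<le> - real k - 1" for t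
    using right_lim_le[of t "- real k"] that k by auto
  then show "\<forall>\<^sub>F t in at_bot. right_lim H t < y"
    unfolding eventually_at_bot_linorder by blast
qed

end

lemma right_continuous_le:
  fixes B C :: "real \<Rightarrow> real"
  assumes B: "continuous (at_right t) B" and le: "\<And>u. t < u \<Longrightarrow> C t \<le> B u"
  shows "C t \<le> B t"
proof (rule tendsto_lowerbound)
  show "(B \<longlongrightarrow> B t) (at_right t)" using B by (simp add: continuous_within)
  show "\<forall>\<^sub>F u in at_right t. C t \<le> B u"
    using le by (auto simp: eventually_at_filter intro: always_eventually)
qed simp

section \<open>Recovering a transport kernel, its marginal and its barycentres\<close>

context two_laws
begin

text \<open>The marginal identity is known only for almost every level. Such levels are dense and
  both sides are monotone, so comparison through one of them strictly between s and t gives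
  inequalities at all points.\<close>

lemma marginal_squeeze:
  assumes F: "F \<in> cond_cdfs" and "s < t"
  shows "cdf \<nu> s \<le> (LINT x|\<mu>. F t x)" "(LINT x|\<mu>. F s x) \<le> cdf \<nu> t"
proof -
  obtain u where u: "s < u" "u < t" "(LINT x|\<mu>. F u x) = cdf \<nu> u"
    using AE_lborel_exists_between[OF cond_cdfsD(5)[OF F] \<open>s < t\<close>] .
  have mono: "(LINT x|\<mu>. F r x) \<le> (LINT x|\<mu>. F r' x)" if "r \<le> r'" for r r'
    using cond_cdfs_integrable[OF F] cond_cdfsD(4)[OF F that] by (intro integral_mono) auto
  show "cdf \<nu> s \<le> (LINT x|\<mu>. F t x)" "(LINT x|\<mu>. F s x) \<le> cdf \<nu> t"
    using mono[of u t] mono[of s u] u nu.cdf_nondecreasing[of s u] nu.cdf_nondecreasing[of u t] by auto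
qed

lemma AE_tendsto_at_infinity:
  assumes F: "F \<in> cond_cdfs"
  shows "AE x in \<mu>. (\<lambda>k. F (real k) x) \<longlonglongrightarrow> 1" "AE x in \<mu>. (\<lambda>k. F (- real k) x) \<longlonglongrightarrow> 0"
proof -
  note bd = cond_cdfsD(2,3)[OF F] and mono = cond_cdfsD(4)[OF F]
  \<comment> \<open>A bounded decreasing sequence converges at every x. Dominated convergence shows
    that its nonnegative limit has integral 0, so the limit vanishes almost everywhere. This serves
    both \<open>1 - F (real k) x\<close> and \<open>F (- real k) x\<close>.\<close>
  have main: "AE x in \<mu>. (\<lambda>k. f k x) \<longlonglongrightarrow> 0"
    if f: "\<And>k. f k \<in> borel_measurable \<mu>" "\<And>k x. 0 \<le> f k x" "\<And>k x. f k x \<le> 1"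
      and anti: "\<And>i k x. i \<le> k \<Longrightarrow> f k x \<le> f i x"
      and lim: "(\<lambda>k. LINT x|\<mu>. f k x) \<longlonglongrightarrow> 0"
    for f :: "nat \<Rightarrow> real \<Rightarrow> real"
  proof -
    define g where "g x = lim (\<lambda>k. f k x)" for x
    have g: "(\<lambda>k. f k x) \<longlonglongrightarrow> g x" for x
    proof -
      have "convergent (\<lambda>k. f k x)"
      proof (rule Bseq_monoseq_convergent)
        show "Bseq (\<lambda>k. f k x)"
          using f(2,3) by (intro BseqI'[of _ 1]) auto
        show "monoseq (\<lambda>k. f k x)"
          using anti by (auto simp: monoseq_def)
      qed
      then show ?thesis by (simp add: g_def convergent_LIMSEQ_iff)
    qed
    have g_meas: "g \<in> borel_measurable \<mu>"
      using g f(1) by (rule borel_measurable_LIMSEQ_real)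
    have g_nonneg: "0 \<le> g x" for x
      using g by (rule LIMSEQ_le_const) (use f(2) in auto)
    have g_le: "g x \<le> 1" for x
      using g by (rule LIMSEQ_le_const2) (use f(3) in auto)
    have g_int: "integrable \<mu> g"
      using g_meas g_nonneg g_le by (intro mu.integrable_const_bound[where B=1]) auto
    have "(\<lambda>k. LINT x|\<mu>. f k x) \<longlonglongrightarrow> (LINT x|\<mu>. g x)"
      using g f g_meas by (intro integral_dominated_convergence[where w="\<lambda>_. 1"]) auto
    then have "(LINT x|\<mu>. g x) = 0"
      using lim LIMSEQ_unique by blast
    then have "AE x in \<mu>. g x = 0"
      using g_int g_nonneg by (intro mu.AE_eq_0_if_integral_eq_0)
    then show ?thesis
      by eventually_elim (use g in metis)
  qed
  have "AE x in \<mu>. (\<lambda>k. 1 - F (real k) x) \<longlonglongrightarrow> 0"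
  proof (rule main)
    have "(\<lambda>k. 1 - (LINT x|\<mu>. F (real k) x)) \<longlonglongrightarrow> 0"
    proof (rule tendsto_sandwich[OF _ _ tendsto_const])
      \<comment> \<open>The shift by 1 supplies the strict inequality that
        \<open>marginal_squeeze\<close> requires.\<close>
      have "(\<lambda>k. 1 - cdf \<nu> (real k - 1)) \<longlonglongrightarrow> 1 - 1"
      proof (intro tendsto_diff tendsto_const filterlim_compose[OF nu.cdf_lim_at_top_prob])
        have "\<exists>n. \<forall>k\<ge>n. z \<le> real k - 1" for z
          by (intro exI[of _ "nat \<lceil>z + 1\<rceil>"]) linarith
        then show "filterlim (\<lambda>k. real k - 1) at_top sequentially"
          by (simp add: filterlim_at_top eventually_sequentially)
      qed
      then show "(\<lambda>k. 1 - cdf \<nu> (real k - 1)) \<longlonglongrightarrow> 0" by simp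
      show "\<forall>\<^sub>F k in sequentially. 1 - (LINT x|\<mu>. F (real k) x) \<le> 1 - cdf \<nu> (real k - 1)"
        using marginal_squeeze(1)[OF F] by (auto intro!: always_eventually)
      have "(LINT x|\<mu>. F (real k) x) \<le> (LINT x|\<mu>. 1)" for k
        using cond_cdfs_integrable[OF F] bd by (intro integral_mono) auto
      then show "\<forall>\<^sub>F k in sequentially. 0 \<le> 1 - (LINT x|\<mu>. F (real k) x)"
        using mu.prob_space by (auto intro!: always_eventually)
    qed
    then show "(\<lambda>k. LINT x|\<mu>. 1 - F (real k) x) \<longlonglongrightarrow> 0"
      using cond_cdfs_integrable[OF F] mu.prob_space by simp
  qed (use bd mono cond_cdfs_measurable(2)[OF F] in auto)
  then show "AE x in \<mu>. (\<lambda>k. F (real k) x) \<longlonglongrightarrow> 1"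
  proof eventually_elim
    case (elim x)
    from tendsto_diff[OF tendsto_const[of 1] this] show ?case by simp
  qed
  show "AE x in \<mu>. (\<lambda>k. F (- real k) x) \<longlonglongrightarrow> 0"
  proof (rule main)
    show "(\<lambda>k. LINT x|\<mu>. F (- real k) x) \<longlonglongrightarrow> 0"
    proof (rule tendsto_sandwich[OF _ _ tendsto_const])
      show "(\<lambda>k. cdf \<nu> (- real k + 1)) \<longlonglongrightarrow> 0"
      proof (rule filterlim_compose[OF nu.cdf_lim_at_bot])
        have "\<exists>n. \<forall>k\<ge>n. - real k + 1 \<le> z" for z
          by (intro exI[of _ "nat \<lceil>1 - z\<rceil>"]) linarith
        then show "filterlim (\<lambda>k. - real k + 1) at_bot sequentially"
          by (simp add: filterlim_at_bot eventually_sequentially)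
      qed
      show "\<forall>\<^sub>F k in sequentially. (LINT x|\<mu>. F (- real k) x) \<le> cdf \<nu> (- real k + 1)"
        using marginal_squeeze(2)[OF F] by (auto intro!: always_eventually)
    qed (use bd in \<open>auto intro!: always_eventually integral_nonneg_AE\<close>)
  qed (use bd mono cond_cdfs_measurable(2)[OF F] in auto)
qed

lemma real_distribution_kernel:
  assumes "p \<in> borel \<rightarrow>\<^sub>M prob_algebra borel"
  shows "real_distribution (p x)"
proof -
  have "p x \<in> space (prob_algebra borel)"
    using measurable_space[OF assms, of x] by simp
  then show ?thesis
    by (auto simp: space_prob_algebra real_distribution_def real_distribution_axioms_def)
qed

lemma kernel_measurable:
  assumes "p \<in> borel \<rightarrow>\<^sub>M prob_algebra borel"
  shows "p \<in> borel \<rightarrow>\<^sub>M subprob_algebra borel" "p \<in> \<mu> \<rightarrow>\<^sub>M subprob_algebra borel"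
proof -
  show "p \<in> borel \<rightarrow>\<^sub>M subprob_algebra borel"
    using assms by (rule measurable_prob_algebraD)
  then show "p \<in> \<mu> \<rightarrow>\<^sub>M subprob_algebra borel"
    by (simp cong: measurable_cong_sets)
qed

lemma cdf_bind:
  assumes "p \<in> borel \<rightarrow>\<^sub>M prob_algebra borel"
  shows "cdf (bind \<mu> p) t = (LINT x|\<mu>. cdf (p x) t)"
  unfolding cdf_def by (rule mu.measure_bind[OF kernel_measurable(2)[OF assms]]) simp

text \<open>The barycentres agree only almost everywhere, because the finite first moment of \<nu>
  makes the first moment of \<open>p x\<close> finite only for almost every x.\<close>

lemma cond_cdf_of_kernel:
  assumes p: "p \<in> borel \<rightarrow>\<^sub>M prob_algebra borel" and bind: "bind \<mu> p = \<nu>"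
  shows "(\<lambda>t x. cdf (p x) t) \<in> cond_cdfs"
    and "AE x in \<mu>. bary (\<lambda>t x. cdf (p x) t) x = (LINT y|p x. y)"
proof -
  have rd: "real_distribution (p x)" for x using p by (rule real_distribution_kernel)
  have [measurable]: "p \<in> borel \<rightarrow>\<^sub>M subprob_algebra borel"
    using p by (rule kernel_measurable)
  have "(\<lambda>(t, x). cdf (p x) t) \<in> borel_measurable (borel \<Otimes>\<^sub>M borel)"
  proof -
    have "(\<lambda>z. measure (p (snd z)) {..fst z}) \<in> borel_measurable (borel \<Otimes>\<^sub>M borel)"
    proof (rule measure_measurable_subprob_algebra2)
      have "{w \<in> space ((borel \<Otimes>\<^sub>M borel) \<Otimes>\<^sub>M borel). snd w \<le> fst (fst w)}
          \<in> sets ((borel \<Otimes>\<^sub>M borel) \<Otimes>\<^sub>M (borel :: real measure))"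
        by measurable
      also have "{w \<in> space ((borel \<Otimes>\<^sub>M borel) \<Otimes>\<^sub>M borel). snd w \<le> fst (fst w)}
          = (SIGMA z:space (borel \<Otimes>\<^sub>M (borel :: real measure)). {..fst z :: real})"
        by (auto simp: space_pair_measure)
      finally show "(SIGMA z:space (borel \<Otimes>\<^sub>M (borel :: real measure)). {..fst z :: real})
          \<in> sets ((borel \<Otimes>\<^sub>M borel) \<Otimes>\<^sub>M borel)" .
    qed measurable
    then show ?thesis by (simp add: cdf_def case_prod_beta')
  qed
  moreover have "(LINT x|\<mu>. cdf (p x) t) = cdf \<nu> t" for t
    using cdf_bind[OF p, of t] bind by simp
  ultimately show "(\<lambda>t x. cdf (p x) t) \<in> cond_cdfs"
    using real_distribution.cdf_bounded_prob[OF rd]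
      finite_borel_measure.cdf_nonneg[OF real_distribution.finite_borel_measure_M[OF rd]]
      finite_borel_measure.cdf_nondecreasing[OF real_distribution.finite_borel_measure_M[OF rd]]
    by (auto simp: cond_cdfs_def)
  have "(\<integral>\<^sup>+x. \<integral>\<^sup>+y. ennreal \<bar>y\<bar> \<partial>p x \<partial>\<mu>) = (\<integral>\<^sup>+y. ennreal \<bar>y\<bar> \<partial>\<nu>)"
    unfolding bind[symmetric] by (rule nn_integral_bind[OF _ kernel_measurable(2)[OF p], symmetric]) simp
  also have "\<dots> < \<infinity>"
    using integrable_nu by (simp add: integrable_iff_bounded)
  finally have fin: "(\<integral>\<^sup>+x. \<integral>\<^sup>+y. ennreal \<bar>y\<bar> \<partial>p x \<partial>\<mu>) \<noteq> \<infinity>" by simp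
  have "(\<lambda>x. \<integral>\<^sup>+y. ennreal \<bar>y\<bar> \<partial>p x) \<in> borel_measurable \<mu>"
    by (rule measurable_compose[OF kernel_measurable(2)[OF p] nn_integral_measurable_subprob_algebra]) simp
  from nn_integral_PInf_AE[OF this fin]
  show "AE x in \<mu>. bary (\<lambda>t x. cdf (p x) t) x = (LINT y|p x. y)"
  proof eventually_elim
    case (elim x)
    interpret real_distribution "p x" by (rule rd)
    have "integrable (p x) (\<lambda>y. y)"
      using elim by (intro integrableI_bounded) (auto simp: less_top)
    then show ?case
      unfolding bary_def by (rule integral_step_minus_cdf)
  qed
qed

text \<open>For almost every x the law \<open>p x\<close> has the right-continuous version of
  \<open>\<lambda>t. F t x\<close> as distribution function. At t this version is at least
  \<open>F t x\<close>, and at any s < t it is at most \<open>F t x\<close>; these bounds determine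
  the second marginal by right continuity, and then the barycentres.\<close>

lemma kernel_of_cond_cdf:
  assumes F: "F \<in> cond_cdfs"
  obtains p where "p \<in> borel \<rightarrow>\<^sub>M prob_algebra borel" "bind \<mu> p = \<nu>"
    "AE x in \<mu>. (LINT y|p x. y) = bary F x"
proof -
  have mono: "mono (\<lambda>t. F t x)" and bd: "0 \<le> F t x" "F t x \<le> 1" for t x
    using cond_cdfsD[OF F] by (auto intro: monoI)
  note rl = mono bd
  have "AE x in \<mu>. (\<lambda>k. F (real k) x) \<longlonglongrightarrow> 1 \<and> (\<lambda>k. F (- real k) x) \<longlonglongrightarrow> 0"
    using AE_tendsto_at_infinity[OF F] by eventually_elim simp
  then obtain N where N: "{x \<in> space \<mu>. \<not> ((\<lambda>k. F (real k) x) \<longlonglongrightarrow> 1 \<and> (\<lambda>k. F (- real k) x) \<longlonglongrightarrow> 0)} \<subseteq> N"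
    "N \<in> null_sets \<mu>"
    unfolding eventually_ae_filter by blast
  have N_borel [measurable]: "N \<in> sets borel" using N(2) by (auto simp: null_sets_def)
  have AE_N: "AE x in \<mu>. x \<notin> N" using N(2) by (rule AE_not_in)
  have lims: "(\<lambda>k. F (real k) x) \<longlonglongrightarrow> 1" "(\<lambda>k. F (- real k) x) \<longlonglongrightarrow> 0" if "x \<notin> N" for x
    using that N(1) by auto
  define R where "R x = right_lim (\<lambda>t. F t x)" for x
  \<comment> \<open>On the null set where the limits at infinity may fail, a fixed law, here the
    point mass at 0, keeps \<open>p\<close> a Markov kernel.\<close>
  define p where "p x = (if x \<in> N then return borel 0 else interval_measure (R x))" for x
  have rd: "real_distribution (p x)" for x
  proof (cases "x \<in> N")
    case True
    then show ?thesis
      by (auto simp: p_def real_distribution_def real_distribution_axioms_def intro!: prob_space_return)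
  next
    case False
    then show ?thesis
      unfolding p_def R_def
      using right_lim_mono[OF rl] right_lim_right_continuous[OF rl] right_lim_at_bot[OF rl] right_lim_at_top[OF rl] lims
      by (auto intro!: real_distribution_interval_measure)
  qed
  have cdf_p: "cdf (p x) t = R x t" if "x \<notin> N" for x t
  proof -
    have "cdf (interval_measure (R x)) = R x"
      unfolding R_def
      using right_lim_mono[OF rl] right_lim_right_continuous[OF rl] right_lim_at_bot[OF rl] lims[OF that]
      by (intro cdf_interval_measure) auto
    then show ?thesis using that by (simp add: p_def)
  qed
  have p: "p \<in> borel \<rightarrow>\<^sub>M prob_algebra borel"
  proof (rule measurable_prob_algebra_generated)
    show "sets (borel :: real measure) = sigma_sets UNIV (range atMost)"
      by (subst borel_eq_atMost) simp
    show "Int_stable (range (atMost :: real \<Rightarrow> real set))"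
      by (auto simp: Int_stable_def)
    show "prob_space (p x)" for x
      using rd by (simp add: real_distribution_def)
    show "sets (p x) = sets borel" for x
      using rd by (simp add: real_distribution_def real_distribution_axioms_def)
    fix A :: "real set" assume "A \<in> range atMost"
    then obtain t where A: "A = {..t}" by auto
    have "emeasure (p x) A = (if x \<in> N then indicator {..t} 0 else ennreal (R x t))" for x
    proof (cases "x \<in> N")
      case False
      interpret real_distribution "p x" by (rule rd)
      show ?thesis
        using False cdf_p[OF False, of t] by (simp add: A emeasure_eq_measure cdf_def)
    qed (simp add: p_def A)
    moreover have "(\<lambda>x. R x t) \<in> borel_measurable borel"
    proof -
      have "F s \<in> borel_measurable borel" for s
        using cond_cdfs_measurable(2)[OF F, of s] by simp
      then show ?thesis
        unfolding R_def right_lim_def using bd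
        by (intro borel_measurable_cINF) (auto intro!: bdd_belowI2[of _ 0])
    qed
    ultimately show "(\<lambda>x. emeasure (p x) A) \<in> borel_measurable borel"
      by simp
  qed simp
  have int_p: "integrable \<mu> (\<lambda>x. cdf (p x) t)" for t
  proof (rule mu.integrable_const_bound[where B=1])
    show "(\<lambda>x. cdf (p x) t) \<in> borel_measurable \<mu>"
      unfolding cdf_def using kernel_measurable(2)[OF p] by measurable
    show "AE x in \<mu>. norm (cdf (p x) t) \<le> 1"
      using real_distribution.cdf_bounded_prob[OF rd]
        finite_borel_measure.cdf_nonneg[OF real_distribution.finite_borel_measure_M[OF rd]] by simp
  qed
  have F_le: "(LINT x|\<mu>. F t x) \<le> cdf (bind \<mu> p) t" for t
    unfolding cdf_bind[OF p]
  proof (rule integral_mono_AE[OF cond_cdfs_integrable[OF F] int_p])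
    show "AE x in \<mu>. F t x \<le> cdf (p x) t"
      using AE_N by eventually_elim (use le_right_lim[OF rl] in \<open>simp add: cdf_p R_def\<close>)
  qed
  have le_F: "cdf (bind \<mu> p) s \<le> (LINT x|\<mu>. F t x)" if "s < t" for s t
    unfolding cdf_bind[OF p]
  proof (rule integral_mono_AE[OF int_p cond_cdfs_integrable[OF F]])
    show "AE x in \<mu>. cdf (p x) s \<le> F t x"
      using AE_N by eventually_elim (use right_lim_le[OF rl that] in \<open>simp add: cdf_p R_def\<close>)
  qed
  have rd_bind: "real_distribution (bind \<mu> p)"
  proof (intro real_distribution.intro real_distribution_axioms.intro)
    show "prob_space (bind \<mu> p)"
      using rd by (intro mu.prob_space_bind[OF _ kernel_measurable(2)[OF p]]) (simp add: real_distribution_def)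
    show "sets (bind \<mu> p) = sets borel"
      using rd by (intro sets_bind) (auto simp: real_distribution_def real_distribution_axioms_def)
  qed
  interpret B: real_distribution "bind \<mu> p" by (rule rd_bind)
  have bind: "bind \<mu> p = \<nu>"
  proof (rule cdf_unique[OF rd_bind nu.real_distribution_axioms], rule ext, rule antisym)
    fix t
    show "cdf (bind \<mu> p) t \<le> cdf \<nu> t"
    proof (rule right_continuous_le[OF nu.cdf_is_right_cont])
      fix u assume "t < u"
      then obtain s where "t < s" "s < u" using dense by blast
      then show "cdf (bind \<mu> p) t \<le> cdf \<nu> u"
        using le_F[of t s] marginal_squeeze(2)[OF F, of s u] by simp
    qed
    show "cdf \<nu> t \<le> cdf (bind \<mu> p) t"
    proof (rule right_continuous_le[OF B.cdf_is_right_cont])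
      fix u assume "t < u"
      then show "cdf \<nu> t \<le> cdf (bind \<mu> p) u"
        using marginal_squeeze(1)[OF F, of t u] F_le[of u] by simp
    qed
  qed
  define G where "G t x = cdf (p x) t" for t x
  have G: "G \<in> cond_cdfs" and G_bary: "AE x in \<mu>. bary G x = (LINT y|p x. y)"
    using cond_cdf_of_kernel[OF p bind] by (auto simp: G_def[abs_def])
  \<comment> \<open>\<open>G\<close> dominates \<open>F\<close> for almost every x, and for almost
    every t both slices have integral \<open>cdf \<nu> t\<close>, so their L1 distance is 0. No
    discussion of the discontinuities of \<open>F\<close> is involved.\<close>
  have "AE t in lborel. (LINT x|\<mu>. \<bar>F t x - G t x\<bar>) = 0"
    using cond_cdfsD(5)[OF F] cond_cdfsD(5)[OF G]
  proof eventually_elim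
    case (elim t)
    have "(LINT x|\<mu>. \<bar>F t x - G t x\<bar>) = (LINT x|\<mu>. G t x - F t x)"
    proof (rule integral_cong_AE)
      show "AE x in \<mu>. \<bar>F t x - G t x\<bar> = G t x - F t x"
        using AE_N by eventually_elim (use le_right_lim[OF rl] in \<open>simp add: G_def cdf_p R_def\<close>)
    qed (use cond_cdfs_measurable(2)[OF F] cond_cdfs_measurable(2)[OF G] in auto)
    then show ?case
      using elim cond_cdfs_integrable[OF F] cond_cdfs_integrable[OF G] by simp
  qed
  then have "(LINT t|lborel. LINT x|\<mu>. \<bar>F t x - G t x\<bar>) = 0"
    by (rule integral_eq_zero_AE)
  then have "(LINT x|\<mu>. \<bar>bary F x - bary G x\<bar>) \<le> 0"
    using integral_abs_bary_diff_le[OF F G] by simp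
  moreover have "0 \<le> (LINT x|\<mu>. \<bar>bary F x - bary G x\<bar>)"
    by (intro integral_nonneg_AE) auto
  ultimately have "(LINT x|\<mu>. \<bar>bary F x - bary G x\<bar>) = 0"
    by (rule antisym)
  then have "AE x in \<mu>. \<bar>bary F x - bary G x\<bar> = 0"
    using integrable_bary[OF F] integrable_bary[OF G] by (intro mu.AE_eq_0_if_integral_eq_0) auto
  with G_bary have "AE x in \<mu>. (LINT y|p x. y) = bary F x"
    by eventually_elim simp
  with p bind show ?thesis by (rule that)
qed

lemma weak_transport_cost_eq:
  obtains F where "F \<in> cond_cdfs"
    "\<And>\<theta>. cost_function \<theta> \<Longrightarrow> weak_transport_cost \<theta> \<nu> \<mu> = (\<integral>\<^sup>+x. ennreal (\<theta> (x - bary F x)) \<partial>\<mu>)"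
proof -
  obtain F where F: "F \<in> cond_cdfs" and opt: "\<And>G \<theta>. G \<in> cond_cdfs \<Longrightarrow> cost_function \<theta> \<Longrightarrow>
      (\<integral>\<^sup>+x. ennreal (\<theta> (x - bary F x)) \<partial>\<mu>) \<le> (\<integral>\<^sup>+x. ennreal (\<theta> (x - bary G x)) \<partial>\<mu>)"
    using universal_minimiser_exists by blast
  have "weak_transport_cost \<theta> \<nu> \<mu> = (\<integral>\<^sup>+x. ennreal (\<theta> (x - bary F x)) \<partial>\<mu>)" if \<theta>: "cost_function \<theta>" for \<theta>
  proof -
    have abs: "\<theta> \<bar>z\<bar> = \<theta> z" for z
      using \<theta> by (auto simp: cost_function_def abs_if)
    show ?thesis
      unfolding weak_transport_cost_def abs
    proof (rule antisym)
      obtain p where p: "p \<in> borel \<rightarrow>\<^sub>M prob_algebra borel" "bind \<mu> p = \<nu>"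
        "AE x in \<mu>. (LINT y|p x. y) = bary F x"
        using kernel_of_cond_cdf[OF F] .
      have "(\<integral>\<^sup>+x. ennreal (\<theta> (x - (LINT y|p x. y))) \<partial>\<mu>) = (\<integral>\<^sup>+x. ennreal (\<theta> (x - bary F x)) \<partial>\<mu>)"
        using p(3) by (intro nn_integral_cong_AE) auto
      then show "(INF p\<in>{p. p \<in> borel \<rightarrow>\<^sub>M prob_algebra borel \<and> bind \<mu> p = \<nu>}.
          \<integral>\<^sup>+x. ennreal (\<theta> (x - (LINT y|p x. y))) \<partial>\<mu>) \<le> (\<integral>\<^sup>+x. ennreal (\<theta> (x - bary F x)) \<partial>\<mu>)"
        using p(1,2) by (intro INF_lower2[of p]) auto
    next
      show "(\<integral>\<^sup>+x. ennreal (\<theta> (x - bary F x)) \<partial>\<mu>) \<le> (INF p\<in>{p. p \<in> borel \<rightarrow>\<^sub>M prob_algebra borel \<and> bind \<mu> p = \<nu>}.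
          \<integral>\<^sup>+x. ennreal (\<theta> (x - (LINT y|p x. y))) \<partial>\<mu>)"
      proof (rule INF_greatest, clarify)
        fix p assume p: "p \<in> borel \<rightarrow>\<^sub>M prob_algebra borel" "\<nu> = bind \<mu> p"
        note G = cond_cdf_of_kernel[OF p(1) p(2)[symmetric]]
        have "(\<integral>\<^sup>+x. ennreal (\<theta> (x - (LINT y|p x. y))) \<partial>\<mu>)
            = (\<integral>\<^sup>+x. ennreal (\<theta> (x - bary (\<lambda>t x. cdf (p x) t) x)) \<partial>\<mu>)"
          using G(2) by (intro nn_integral_cong_AE) auto
        then show "(\<integral>\<^sup>+x. ennreal (\<theta> (x - bary F x)) \<partial>\<mu>) \<le> (\<integral>\<^sup>+x. ennreal (\<theta> (x - (LINT y|p x. y))) \<partial>\<mu>)"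
          using opt[OF G(1) \<theta>] by simp
      qed
    qed
  qed
  with F show ?thesis by (rule that)
qed

end

theorem theorem2p3:
  fixes \<alpha> \<beta> \<theta> :: "real \<Rightarrow> real" and \<mu> \<nu> :: "real measure"
  assumes "cost_function \<alpha>" and "cost_function \<beta>" and "cost_function \<theta>"
    and "\<And>x. \<alpha> x + \<beta> x = \<theta> x"
    and "prob_first_moment \<mu>" and "prob_first_moment \<nu>"
  shows "weak_transport_cost \<theta> \<nu> \<mu> = weak_transport_cost \<alpha> \<nu> \<mu> + weak_transport_cost \<beta> \<nu> \<mu>"
proof -
  interpret two_laws \<mu> \<nu>
    using assms(5,6)
    by (simp add: two_laws_def two_laws_axioms_def prob_first_moment_def real_distribution_def real_distribution_axioms_def)
  obtain F where F: "F \<in> cond_cdfs" and cost: "\<And>\<theta>. cost_function \<theta> \<Longrightarrow>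
      weak_transport_cost \<theta> \<nu> \<mu> = (\<integral>\<^sup>+x. ennreal (\<theta> (x - bary F x)) \<partial>\<mu>)"
    using weak_transport_cost_eq by blast
  have meas: "(\<lambda>x. ennreal (\<gamma> (x - bary F x))) \<in> borel_measurable \<mu>" if "cost_function \<gamma>" for \<gamma>
  proof -
    have [measurable]: "bary F \<in> borel_measurable borel"
      using F by (rule bary_borel_measurable)
    have "continuous_on UNIV \<gamma>"
      using that by (intro convex_on_continuous) (auto simp: cost_function_def)
    then have [measurable]: "\<gamma> \<in> borel_measurable borel"
      by (rule borel_measurable_continuous_onI)
    show ?thesis by measurable
  qed
  have "ennreal (\<theta> z) = ennreal (\<alpha> z) + ennreal (\<beta> z)" for z
    using assms(1,2) by (simp add: assms(4)[symmetric] cost_function_def)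
  then show ?thesis
    using meas[OF assms(1)] meas[OF assms(2)] by (simp add: cost assms(1-3) nn_integral_add)
qed

end
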